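(* Let $H$ be a separable abstract $L^2$-space and let $K:=H_+$ be its positive cone (a self-dual closed convex cone). Then $(K,K)$, i.e. the cone $K$ with generating system $G=K$, is approximately generated by an unconditional Schauder basis.
   Context: Abstract $L^2$-spaces. An ordered vector space is a real vector space $V$ with a reflexive, antisymmetric, transitive relation $\le$ such that $x\le y$ implies $x+z\le y+z$ and $\alpha x\le\alpha y$ for all $z\in V$, $\alpha>0$; its positive cone is $V_+=\{x\in V:x\ge0\}$. A vector lattice is an ordered vector space in which $x\vee y$ (supremum) and $x\wedge y$ (infimum) exist for all $x,y$; $|x|:=x\vee(-x)$. A Banach lattice is a vector lattice with a complete norm such that $|x|\le|y|$ implies $\|x\|\le\|y\|$. A Hilbert lattice is a Banach lattice whose norm is a Hilbert space norm. A Hilbert lattice $H$ is an abstract $L^2$-space if one (equivalently, each) of the following equivalent conditions holds: (a) $\|h+g\|^2=\|h\|^2+\|g\|^2$ for all $h,g\in H_+$ with $h\wedge g=0$; (b) for all $h,g\in H_+$: $h\perp g$ if and only if $h\wedge g=0$; (c) the closed convex cone $H_+$ is self-dual, i.e. $H_+=\{h\in H:\langle h^*,h\rangle\ge0\text{ for all }h^*\in H_+\}$. $H$ is separable if it is separable as a normed space. Cones. A convex cone in a Hilbert space $H$ is a subset $K$ with $\lambda h+\mu g\in K$ for all $\lambda,\mu\ge0$, $h,g\in K$. For $B\subset H$ set $B^*:=\{h\in H:\langle h^*,h\rangle\ge0\text{ for all }h^*\in B\}$. A generating system of a closed convex cone $K$ is a subset $G\subset K^*$ with $G^*=K$; writing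 $(K,G)$ indicates that $G$ is a generating system of $K$. A system $\{e_k^*,e_k\}_{k\in\mathbb{N}}\subset H$ is an unconditional Schauder basis of $H$ if every $h\in H$ satisfies $h=\sum_k\langle e_k^*,h\rangle e_k$ with unconditional convergence, and whenever $h=\sum_kh_ke_k$ converges unconditionally with real $h_k$, then $h_k=\langle e_k^*,h\rangle$ for all $k$ (if $\dim H<\infty$, the index set $\mathbb{N}$ is replaced by a finite one). $(K,G)$ is generated by an unconditional Schauder basis if there is an unconditional Schauder basis $\{e_k^*,e_k\}$ of $H$ with $G\subset\bigcup_k\operatorname{lin}\{e_k^*\}$ ($\operatorname{lin}$ = linear span). $(K,G)$ is approximately generated by an unconditional Schauder basis if: (i) there is a sequence $(K_n,G_n)_{n\in\mathbb{N}}$ of closed convex cones in $H$, each generated by an unconditional Schauder basis; (ii) $K\subset K_{n+1}\subset K_n$ and $G_n\subset G_{n+1}$ for all $n$, and $K=\bigcap_nK_n$; (iii) for all $h^*\in\bigcup_nG_n$ and $h\in K$ with $\langle h^*,h\rangle=0$ there is a sequence $(h_m^* )_{m}\subset G$ with $h_m^*\to h^*$ and $\langle h_m^*,h\rangle=0$ for all $m$; (iv) there are $L>0$ and maps $\pi_n:H\to H$, $n\in\mathbb{N}$, all Lipschitz with constant $L$, such that $\pi_n(K_n)\subset K$ for each $n$ and $\pi_n\to\mathrm{Id}$ pointwise; (v) for all $n$ and all $(h^*,h)\in G_n\times K_n$ with $\langle h^*,h\rangle=0$ we have $\langle h^*,\pi_n(h)\rangle=0$. *)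

theory Defs
  imports "HOL-Analysis.Analysis"
begin

section \<open>Abstract \<open>L\<^sup>2\<close>-spaces\<close>

class vector_lattice = ordered_real_vector + lattice
begin

definition lattice_abs :: "'a \<Rightarrow> 'a"
  where "lattice_abs x = sup x (- x)"

end

class banach_lattice = vector_lattice + banach +
  assumes norm_lattice_mono: "lattice_abs x \<le> lattice_abs y \<Longrightarrow> norm x \<le> norm y"

class hilbert_lattice = banach_lattice + real_inner

text \<open>
  Of the equivalent characterisations of an abstract \<open>L\<^sup>2\<close>-space among Hilbert lattices we take
  additivity of the squared norm on disjoint positive elements as the definition.
\<close>

class abstract_L2_space = hilbert_lattice +
  assumes norm_add_disjoint:
    "0 \<le> h \<Longrightarrow> 0 \<le> g \<Longrightarrow> inf h g = 0 \<Longrightarrow> (norm (h + g))\<^sup>2 = (norm h)\<^sup>2 + (norm g)\<^sup>2"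

instance real :: vector_lattice ..

instance real :: banach_lattice
proof
  fix x y :: real
  assume "lattice_abs x \<le> lattice_abs y"
  then show "norm x \<le> norm y"
    unfolding lattice_abs_def sup_real_def real_norm_def by linarith
qed

instance real :: hilbert_lattice ..

instance real :: abstract_L2_space
proof
  fix h g :: real
  assume "inf h g = 0"
  then have "h = 0 \<or> g = 0"
    unfolding inf_real_def min_def by (simp split: if_splits)
  then show "(norm (h + g))\<^sup>2 = (norm h)\<^sup>2 + (norm g)\<^sup>2"
    by auto
qed

definition positive_cone :: "'a::vector_lattice set"
  where "positive_cone = {x. 0 \<le> x}"

section \<open>Cones and generating systems\<close>

definition dual_cone :: "'a::real_inner set \<Rightarrow> 'a set"
  where "dual_cone B = {h. \<forall>h'\<in>B. 0 \<le> h' \<bullet> h}"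

text \<open>
  The predicate \<^const>\<open>convex_cone\<close> excludes the empty set. This is no restriction here, because
  \<open>dual_cone G\<close> always contains \<open>0\<close>.
\<close>

definition cone_with_generating_system :: "'a::real_inner set \<Rightarrow> 'a set \<Rightarrow> bool"
  where "cone_with_generating_system K G \<longleftrightarrow>
    closed K \<and> convex_cone K \<and> G \<subseteq> dual_cone K \<and> dual_cone G = K"

section \<open>Unconditional Schauder bases\<close>

text \<open>
  The index set \<open>I\<close> is all of the natural numbers, or a finite set if the space has finite
  dimension. Unconditional convergence of a series is convergence of the net of its finite partial
  sums, that is, \<^const>\<open>has_sum\<close>.
\<close>

definition unconditional_schauder_basis ::
    "nat set \<Rightarrow> (nat \<Rightarrow> 'a::real_inner) \<Rightarrow> (nat \<Rightarrow> 'a) \<Rightarrow> bool"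
  where "unconditional_schauder_basis I es e \<longleftrightarrow>
    (if \<exists>B::'a set. finite B \<and> span B = UNIV then finite I else I = UNIV) \<and>
    (\<forall>h. ((\<lambda>k. (es k \<bullet> h) *\<^sub>R e k) has_sum h) I) \<and>
    (\<forall>h c. ((\<lambda>k. c k *\<^sub>R e k) has_sum h) I \<longrightarrow> (\<forall>k\<in>I. c k = es k \<bullet> h))"

definition generated_by_basis :: "'a::real_inner set \<Rightarrow> 'a set \<Rightarrow> bool"
  where "generated_by_basis K G \<longleftrightarrow>
    cone_with_generating_system K G \<and>
    (\<exists>I es e. unconditional_schauder_basis I es e \<and> G \<subseteq> (\<Union>k\<in>I. span {es k}))"

definition approximately_generated_by_basis :: "'a::real_inner set \<Rightarrow> 'a set \<Rightarrow> bool"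
  where "approximately_generated_by_basis K G \<longleftrightarrow>
    cone_with_generating_system K G \<and>
    (\<exists>(Kn :: nat \<Rightarrow> 'a set) (Gn :: nat \<Rightarrow> 'a set) (L :: real) (\<pi> :: nat \<Rightarrow> 'a \<Rightarrow> 'a).
      (\<forall>n. generated_by_basis (Kn n) (Gn n)) \<and>
      (\<forall>n. K \<subseteq> Kn (Suc n) \<and> Kn (Suc n) \<subseteq> Kn n \<and> Gn n \<subseteq> Gn (Suc n)) \<and>
      K = (\<Inter>n. Kn n) \<and>
      (\<forall>h'\<in>(\<Union>n. Gn n). \<forall>h\<in>K. h' \<bullet> h = 0 \<longrightarrow>
        (\<exists>g :: nat \<Rightarrow> 'a. (\<forall>m. g m \<in> G) \<and> g \<longlonglongrightarrow> h' \<and> (\<forall>m. g m \<bullet> h = 0))) \<and>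
      L > 0 \<and>
      (\<forall>n. L-lipschitz_on UNIV (\<pi> n)) \<and>
      (\<forall>n. \<pi> n ` Kn n \<subseteq> K) \<and>
      (\<forall>h. (\<lambda>n. \<pi> n h) \<longlonglongrightarrow> h) \<and>
      (\<forall>n. \<forall>h'\<in>Gn n. \<forall>h\<in>Kn n. h' \<bullet> h = 0 \<longrightarrow> h' \<bullet> \<pi> n h = 0))"

end

theory Submission
  imports Defs
begin

text \<open>
  Think of \<open>H\<close> as an \<open>L\<^sup>2\<close>-space. The cone of functions with nonnegative averages over the cells of a
  finite partition is generated by a basis, namely by the indicators of the cells, and these cones
  decrease to the positive cone when the partitions are refined. The difficulty is the requirement
  that the generating systems increase: the indicator of a cell and the indicators of the pieces into
  which it is cut later are linearly dependent, so they are not coordinate functionals of one basis.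

  The remedy is to perturb. Where the space is diffuse, every cell \<open>x\<close> has a proper piece \<open>w x\<close>, and
  \<open>x + \<epsilon> *\<^sub>R w x\<close> is linearly independent of everything in the span of the current partition
  (\<open>perturbed_independent\<close>). The next partition contains \<open>w x\<close> in its span, so that all earlier
  generators are again simple functions with respect to it. Atoms cannot be cut, but there are only
  countably many, they are pairwise orthogonal, and each is added to the generators just once. In this
  way finite independent sets \<open>G\<^sub>0 \<subseteq> G\<^sub>1 \<subseteq> \<dots>\<close> of positive vectors arise (\<open>stage_sequence\<close>,
  \<open>approximating_systems\<close>), and a finite independent set always generates its dual cone through a basis
  (\<open>generated_by_basis_dual_cone\<close>).

  Let \<open>U\<^sub>n\<close> be the orthogonal system of the perturbed cells of stage \<open>n\<close> and the first \<open>n\<close> atoms. A vector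
  in the dual cone of \<open>G\<^sub>n\<close> has nonnegative coefficients with respect to \<open>U\<^sub>n \<subseteq> G\<^sub>n\<close>, so the orthogonal
  projection onto the span of \<open>U\<^sub>n\<close> maps this cone into the positive cone. However, if \<open>g \<bullet> h = 0\<close> for a
  generator \<open>g\<close> of an earlier stage, the coefficients of \<open>h\<close> on the support of \<open>g\<close> are merely small, of
  the order of the perturbation, and they have to vanish. Soft thresholding of the coefficients at a
  level \<open>\<delta>\<^sub>n * \<parallel>h\<parallel>\<close> removes them (\<open>shrink_vanishes\<close>). It keeps the maps Lipschitz with constant \<open>2\<close>
  (\<open>shrink_lipschitz\<close>) and does not disturb convergence if \<open>\<delta>\<^sub>n\<close> tends to \<open>0\<close> fast enough. The order of
  choices in each stage is therefore: the partition, then \<open>\<delta>\<^sub>n\<close>, then \<open>\<epsilon>\<^sub>n\<close>.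

  No representation of \<open>H\<close> as a function space is used. Measurable sets are replaced by the components
  of a weak unit \<open>e\<close> of the diffuse part, the vectors \<open>0 \<le> p \<le> e\<close> with \<open>p \<bullet> (e - p) = 0\<close>. They arise from
  band projections (\<open>band_component\<close>), finitely many of them have a common refinement
  (\<open>common_refinement\<close>), and nothing nonzero is orthogonal to all of them and to all atoms
  (\<open>atoms_and_lattice_components_total\<close>). By completeness this implies that the projections converge to
  the identity (\<open>orth_proj_tendsto\<close>, \<open>perturbed_orth_proj_tendsto\<close>).
\<close>

section \<open>Orthogonal projections onto finite-dimensional subspaces\<close>

lemma inner_span_eq_0:
  fixes z :: "'a::real_inner"
  assumes "\<And>s. s \<in> S \<Longrightarrow> s \<bullet> z = 0" "y \<in> span S"
  shows "y \<bullet> z = 0"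
  using assms(2)
  by (induction rule: span_induct_alt) (simp_all add: inner_add_left assms(1))

lemma norm_diff_le_of_orthogonal:
  fixes h :: "'a::real_inner"
  assumes "p \<in> span S" "y \<in> span S" "\<And>s. s \<in> S \<Longrightarrow> s \<bullet> (h - p) = 0"
  shows "norm (h - p) \<le> norm (h - y)"
proof -
  have "(p - y) \<bullet> (h - p) = 0"
    using inner_span_eq_0[OF assms(3)] span_diff[OF assms(1,2)] by blast
  then have "(norm (h - y))\<^sup>2 = (norm (h - p))\<^sup>2 + (norm (p - y))\<^sup>2"
    unfolding power2_norm_eq_inner by (simp add: algebra_simps inner_commute)
  then have "(norm (h - p))\<^sup>2 \<le> (norm (h - y))\<^sup>2" by simp
  then show ?thesis by (simp add: power2_le_iff_abs_le)
qed

text \<open>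
  A Gram--Schmidt step: the projection onto the span of \<open>S\<close> is corrected along the residual \<open>r\<close> of
  the new generator \<open>a\<close>. If \<open>r = 0\<close>, the coefficient \<open>c\<close> is \<open>0 / 0 = 0\<close> and nothing has to be
  corrected.
\<close>

lemma projection_on_finite_span:
  fixes h :: "'a::real_inner"
  assumes "finite S"
  shows "\<exists>p\<in>span S. \<forall>s\<in>S. s \<bullet> (h - p) = 0"
  using assms
proof (induction S arbitrary: h rule: finite_induct)
  case empty
  then show ?case by (auto intro: span_zero)
next
  case (insert a S)
  obtain p where p: "p \<in> span S" "\<And>s. s \<in> S \<Longrightarrow> s \<bullet> (h - p) = 0" using insert.IH by blast
  obtain q where q: "q \<in> span S" "\<And>s. s \<in> S \<Longrightarrow> s \<bullet> (a - q) = 0" using insert.IH by blast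
  define r where "r = a - q"
  have r: "r \<in> span (insert a S)" unfolding r_def
    using q(1) span_mono[OF subset_insertI] by (intro span_diff) (auto intro: span_base)
  define c where "c = (r \<bullet> (h - p)) / (r \<bullet> r)"
  define t where "t = h - (p + c *\<^sub>R r)"
  have t: "t = h - p - c *\<^sub>R r" by (simp add: t_def)
  have 1: "s \<bullet> t = 0" if "s \<in> S" for s
    using p(2)[OF that] q(2)[OF that] by (simp add: t r_def inner_diff_right)
  have 2: "r \<bullet> t = 0"
    by (cases "r = 0") (simp_all add: t c_def inner_diff_right)
  have "q \<bullet> t = 0" using inner_span_eq_0[OF 1 q(1)] .
  then have "a \<bullet> t = 0" using 2 by (simp add: r_def inner_diff_left)
  with 1 have "\<forall>s\<in>insert a S. s \<bullet> t = 0" by simp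
  moreover have "p + c *\<^sub>R r \<in> span (insert a S)"
    using r p(1) span_mono[OF subset_insertI] by (intro span_add span_scale) auto
  ultimately show ?case unfolding t_def by blast
qed

text \<open>
  For an orthogonal set this is the orthogonal projection onto its span. Zero vectors in \<open>S\<close> do no
  harm, since their coefficient is \<open>0 / 0 = 0\<close>.
\<close>

definition orth_proj :: "'a::real_inner set \<Rightarrow> 'a \<Rightarrow> 'a"
  where "orth_proj S h = (\<Sum>s\<in>S. ((s \<bullet> h) / (s \<bullet> s)) *\<^sub>R s)"

lemma orth_proj_in_span: "orth_proj S h \<in> span S"
  unfolding orth_proj_def by (intro span_sum span_scale span_base)

lemma inner_sum_orthogonal:
  fixes S :: "'a::real_inner set"
  assumes "finite S" "pairwise orthogonal S" "s \<in> S"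
  shows "s \<bullet> (\<Sum>t\<in>S. c t *\<^sub>R t) = c s * (s \<bullet> s)"
proof -
  have "s \<bullet> (\<Sum>t\<in>S. c t *\<^sub>R t) = (\<Sum>t\<in>S. if t = s then c s * (s \<bullet> s) else 0)"
    unfolding inner_sum_right using assms(2,3)
    by (intro sum.cong) (auto simp: pairwise_def orthogonal_def)
  then show ?thesis using assms by simp
qed

lemma norm_sum_orthogonal:
  fixes S :: "'a::real_inner set"
  assumes "finite S" "pairwise orthogonal S"
  shows "(norm (\<Sum>t\<in>S. c t *\<^sub>R t))\<^sup>2 = (\<Sum>t\<in>S. (c t)\<^sup>2 * (t \<bullet> t))"
  unfolding power2_norm_eq_inner inner_sum_left
  using inner_sum_orthogonal[OF assms] by (intro sum.cong) (auto simp: power2_eq_square)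

lemma inner_orth_proj:
  assumes "finite S" "pairwise orthogonal S" "s \<in> S"
  shows "s \<bullet> (h - orth_proj S h) = 0"
  using inner_sum_orthogonal[OF assms, of "\<lambda>s. (s \<bullet> h) / (s \<bullet> s)"]
  by (cases "s = 0") (auto simp: orth_proj_def inner_diff_right)

lemma orth_proj_best:
  assumes "finite S" "pairwise orthogonal S" "y \<in> span S"
  shows "norm (h - orth_proj S h) \<le> norm (h - y)"
  using norm_diff_le_of_orthogonal[OF orth_proj_in_span assms(3) inner_orth_proj[OF assms(1,2)]]
  by blast

lemma orth_proj_fixes_span:
  assumes "finite S" "pairwise orthogonal S" "y \<in> span S"
  shows "orth_proj S y = y"
  using orth_proj_best[OF assms, of y] by simp

lemma bessel_inequality:
  fixes S :: "'a::real_inner set"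
  assumes "finite S" "pairwise orthogonal S"
  shows "(\<Sum>s\<in>S. (s \<bullet> h)\<^sup>2 / (s \<bullet> s)) \<le> (norm h)\<^sup>2"
proof -
  let ?p = "orth_proj S h"
  have "?p \<bullet> (h - ?p) = 0"
    using inner_span_eq_0[OF inner_orth_proj[OF assms] orth_proj_in_span] .
  then have "(norm h)\<^sup>2 = (norm ?p)\<^sup>2 + (norm (h - ?p))\<^sup>2"
    unfolding power2_norm_eq_inner by (simp add: algebra_simps inner_commute)
  then have "(norm ?p)\<^sup>2 \<le> (norm h)\<^sup>2" by simp
  moreover have "(norm ?p)\<^sup>2 = (\<Sum>s\<in>S. (s \<bullet> h)\<^sup>2 / (s \<bullet> s))"
    unfolding orth_proj_def norm_sum_orthogonal[OF assms]
    by (intro sum.cong) (auto simp: power2_eq_square)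
  ultimately show ?thesis by simp
qed

text \<open>
  An increasing sequence of orthogonal systems is total as soon as nothing is orthogonal to all of
  them: the residuals \<open>h - P\<^sub>n h\<close> have decreasing norms, hence form a Cauchy sequence by
  Pythagoras, and their limit is orthogonal to every system.
\<close>

lemma orth_proj_tendsto:
  fixes S :: "nat \<Rightarrow> 'a::{real_inner, banach} set"
  assumes fin: "\<And>n. finite (S n)" and orth: "\<And>n. pairwise orthogonal (S n)"
    and mono: "\<And>n. S n \<subseteq> span (S (Suc n))"
    and total: "\<And>x. (\<And>n s. s \<in> S n \<Longrightarrow> s \<bullet> x = 0) \<Longrightarrow> x = 0"
  shows "(\<lambda>n. orth_proj (S n) h) \<longlonglongrightarrow> h"
proof -
  define r where "r n = h - orth_proj (S n) h" for n
  have span_mono': "span (S m) \<subseteq> span (S n)" if "m \<le> n" for m n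
    using that
  proof (induction rule: dec_induct)
    case (step k)
    have "span (S k) \<subseteq> span (S (Suc k))" by (rule span_minimal[OF mono subspace_span])
    with step.IH show ?case by (rule order_trans)
  qed simp
  have r_orth: "s \<bullet> r n = 0" if "s \<in> span (S m)" "m \<le> n" for s m n
    unfolding r_def
    by (rule inner_span_eq_0[of "S n"]) (use inner_orth_proj[OF fin orth] span_mono'[OF that(2)] that(1) in auto)
  have pyth: "(norm (r m - r n))\<^sup>2 = (norm (r m))\<^sup>2 - (norm (r n))\<^sup>2" if "m \<le> n" for m n
  proof -
    have "r m - r n \<in> span (S n)"
      unfolding r_def using orth_proj_in_span span_mono'[OF that] by (auto intro!: span_diff)
    from r_orth[OF this] have "(r m - r n) \<bullet> r n = 0" by simp
    then show ?thesis unfolding power2_norm_eq_inner by (simp add: algebra_simps inner_commute)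
  qed
  have "decseq (\<lambda>n. (norm (r n))\<^sup>2)"
  proof (rule decseq_SucI)
    fix n
    show "(norm (r (Suc n)))\<^sup>2 \<le> (norm (r n))\<^sup>2"
      using pyth[of n "Suc n"] zero_le_power2[of "norm (r n - r (Suc n))"] by simp
  qed
  then have "convergent (\<lambda>n. (norm (r n))\<^sup>2)"
    using decseq_convergent[of _ 0] by (metis convergentI zero_le_power2)
  then have cau: "Cauchy (\<lambda>n. (norm (r n))\<^sup>2)" by (simp add: Cauchy_convergent_iff)
  have "Cauchy r"
  proof (rule metric_CauchyI)
    fix e :: real assume "0 < e"
    then obtain N where N: "\<And>m n. m \<ge> N \<Longrightarrow> n \<ge> N \<Longrightarrow> \<bar>(norm (r m))\<^sup>2 - (norm (r n))\<^sup>2\<bar> < e\<^sup>2"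
      using metric_CauchyD[OF cau, of "e\<^sup>2"] by (auto simp: dist_real_def)
    have *: "dist (r m) (r n) < e" if "m \<ge> N" "n \<ge> N" "m \<le> n" for m n
    proof -
      have "(norm (r m - r n))\<^sup>2 < e\<^sup>2"
        using N[OF that(1,2)] pyth[OF that(3)] by linarith
      then show ?thesis using \<open>0 < e\<close> by (simp add: dist_norm power_less_imp_less_base)
    qed
    show "\<exists>M. \<forall>m\<ge>M. \<forall>n\<ge>M. dist (r m) (r n) < e"
      using * by (metis dist_commute nle_le)
  qed
  then obtain l where l: "r \<longlonglongrightarrow> l" by (meson Cauchy_convergent convergent_def)
  have "l = 0"
  proof (rule total)
    fix m s assume s: "s \<in> S m"
    have "(\<lambda>n. s \<bullet> r n) \<longlonglongrightarrow> s \<bullet> l" by (intro tendsto_intros l)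
    moreover have "(\<lambda>n. s \<bullet> r n) \<longlonglongrightarrow> 0"
      using r_orth[OF span_base[OF s]] by (auto intro!: tendsto_eventually eventually_sequentiallyI[of m])
    ultimately show "s \<bullet> l = 0" by (rule LIMSEQ_unique)
  qed
  then have "(\<lambda>n. h - r n) \<longlonglongrightarrow> h - 0" using l by (intro tendsto_intros) auto
  then show ?thesis by (simp add: r_def)
qed

section \<open>Separability\<close>

text \<open>
  Density passes to subsets because the metric balls around a countable dense set with radii
  \<open>1 / (k + 1)\<close> form a countable family; one point of \<open>S\<close> is picked in each ball that meets \<open>S\<close>.
\<close>

lemma dense_sequence_in_subset:
  fixes S :: "'a::real_normed_vector set"
  assumes sep: "separable_space (euclidean :: 'a topology)" and ne: "S \<noteq> {}"
  shows "\<exists>x :: nat \<Rightarrow> 'a. range x \<subseteq> S \<and> (\<forall>h\<in>S. \<forall>e>0. \<exists>n. dist (x n) h < e)"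
proof -
  obtain C :: "'a set" where C: "countable C" "closure C = UNIV"
    using sep by (auto simp: separable_space_def)
  define pick where "pick c k = (if \<exists>s\<in>S. dist s c < inverse (real (Suc k))
     then SOME s. s \<in> S \<and> dist s c < inverse (real (Suc k)) else SOME s. s \<in> S)" for c k
  have pick1: "pick c k \<in> S" for c k
    unfolding pick_def using someI_ex[of "\<lambda>s. s \<in> S \<and> dist s c < inverse (real (Suc k))"]
      someI_ex[of "\<lambda>s. s \<in> S"] ne by (auto simp del: of_nat_Suc)
  have pick2: "dist (pick c k) c < inverse (real (Suc k))"
    if "s \<in> S" "dist s c < inverse (real (Suc k))" for c k s
    unfolding pick_def using someI_ex[of "\<lambda>s. s \<in> S \<and> dist s c < inverse (real (Suc k))"]
      that by (auto simp del: of_nat_Suc)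
  define T where "T = (\<lambda>(c, k). pick c k) ` (C \<times> (UNIV :: nat set))"
  have T: "countable T" "T \<subseteq> S" "T \<noteq> {}"
    using C pick1 by (auto simp: T_def)
  have dense: "\<exists>t\<in>T. dist t h < e" if h: "h \<in> S" "0 < e" for h e
  proof -
    obtain k where k: "inverse (real (Suc k)) < e / 2"
      using reals_Archimedean[of "e / 2"] h(2) by auto
    obtain c where c: "c \<in> C" "dist c h < inverse (real (Suc k))"
      using C(2) closure_approachable[of h C] by (metis UNIV_I inverse_positive_iff_positive of_nat_0_less_iff zero_less_Suc)
    have "dist (pick c k) c < inverse (real (Suc k))"
      using pick2[OF h(1)] c by (simp add: dist_commute)
    then have "dist (pick c k) h < e"
      using dist_triangle[of "pick c k" h c] c(2) k by linarith
    then show ?thesis using c(1) by (auto simp: T_def)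
  qed
  show ?thesis
    using range_from_nat_into[OF T(3,1)] T(2) dense
    by (intro exI[of _ "from_nat_into T"]) (metis rangeE)
qed

text \<open>
  Two distinct orthonormal vectors have distance \<open>\<surd>2 > 1\<close>, so they cannot share a point of the dense
  sequence within distance \<open>1/2\<close>.
\<close>

lemma orthonormal_countable:
  fixes A :: "'a::real_inner set"
  assumes sep: "separable_space (euclidean :: 'a topology)"
    and orth: "pairwise orthogonal A" and unit: "\<And>a. a \<in> A \<Longrightarrow> norm a = 1"
  shows "countable A"
proof -
  obtain x :: "nat \<Rightarrow> 'a" where x: "\<And>h e. 0 < e \<Longrightarrow> \<exists>n. dist (x n) h < e"
    using dense_sequence_in_subset[OF sep, of UNIV] by auto
  define f where "f a = (SOME n. dist (x n) a < 1/2)" for a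
  have f: "dist (x (f a)) a < 1/2" for a
    unfolding f_def using someI_ex[OF x[of "1/2" a]] by simp
  have "inj_on f A"
  proof (rule inj_onI, rule ccontr)
    fix a b assume ab: "a \<in> A" "b \<in> A" "f a = f b" "a \<noteq> b"
    then have "a \<bullet> b = 0" using orth by (auto simp: pairwise_def orthogonal_def)
    then have "(norm (a - b))\<^sup>2 = 2"
      using unit[OF ab(1)] unit[OF ab(2)]
      unfolding power2_norm_eq_inner by (simp add: algebra_simps inner_commute norm_eq_1)
    moreover have "norm (a - b) < 1"
      using f[of a] f[of b] ab(3) dist_triangle2[of a b "x (f a)"] by (simp add: dist_norm norm_minus_commute)
    then have "(norm (a - b))\<^sup>2 < 1" by (simp add: abs_square_less_1)
    ultimately show False by simp
  qed
  then show ?thesis by (rule countableI)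
qed

section \<open>Cones with finitely many linearly independent generators\<close>

text \<open>
  Each new vector \<open>u\<close> is detected by a functional \<open>z\<close> that vanishes on all the other vectors.
\<close>

lemma independent_Un:
  fixes S N :: "'a::real_inner set"
  assumes "finite N" "independent S"
    and "\<And>u. u \<in> N \<Longrightarrow> \<exists>z. (\<forall>s\<in>S \<union> (N - {u}). s \<bullet> z = 0) \<and> u \<bullet> z \<noteq> 0"
  shows "independent (S \<union> N)"
  using assms(1,3)
proof (induction N rule: finite_induct)
  case empty
  then show ?case using assms(2) by simp
next
  case (insert u N)
  have "\<exists>z. (\<forall>s\<in>S \<union> (N - {v}). s \<bullet> z = 0) \<and> v \<bullet> z \<noteq> 0" if "v \<in> N" for v
    using insert.prems[of v] that by blast
  then have ind: "independent (S \<union> N)" by (rule insert.IH)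
  obtain z where z: "\<And>s. s \<in> S \<union> N \<Longrightarrow> s \<bullet> z = 0" "u \<bullet> z \<noteq> 0"
    using insert.prems[of u] insert.hyps(2) by auto
  have "u \<notin> span (S \<union> N)" using inner_span_eq_0[of "S \<union> N" z u] z by blast
  then have "independent (insert u (S \<union> N))" using ind by (simp add: independent_insert)
  then show ?case by simp
qed

text \<open>
  The residual of \<open>g\<close> after projection onto the span of the other vectors is orthogonal to them, and
  it is nonzero by independence; rescaled, it is the dual vector of \<open>g\<close>.
\<close>

lemma dual_vectors:
  fixes G :: "'a::real_inner set"
  assumes "finite G" "independent G"
  shows "\<exists>d. \<forall>g\<in>G. d g \<in> span G \<and> (\<forall>g'\<in>G. g' \<bullet> d g = (if g' = g then 1 else 0))"
proof (rule bchoice, rule ballI)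
  fix g assume g: "g \<in> G"
  obtain q where q: "q \<in> span (G - {g})" "\<And>s. s \<in> G - {g} \<Longrightarrow> s \<bullet> (g - q) = 0"
    using projection_on_finite_span[of "G - {g}" g] assms(1) by auto
  define r where "r = g - q"
  have "g \<notin> span (G - {g})" using assms(2) g by (auto simp: dependent_def)
  then have r0: "r \<noteq> 0" using q(1) by (auto simp: r_def)
  have rspan: "r \<in> span G"
    unfolding r_def using g q(1) span_mono[of "G - {g}" G] by (intro span_diff) (auto intro: span_base)
  have "q \<bullet> r = 0" unfolding r_def by (rule inner_span_eq_0[OF q(2) q(1)])
  then have gr: "g \<bullet> r = r \<bullet> r" by (simp add: r_def algebra_simps)
  show "\<exists>d. d \<in> span G \<and> (\<forall>g'\<in>G. g' \<bullet> d = (if g' = g then 1 else 0))"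
    using q(2) gr r0 rspan unfolding r_def[symmetric]
    by (intro exI[of _ "(1 / (r \<bullet> r)) *\<^sub>R r"]) (auto intro!: span_scale)
qed

text \<open>
  Gram--Schmidt along the sequence \<open>x\<close>, modulo \<open>G\<close>: each step adds the normalised residual of the
  next member, unless it is \<open>0\<close>. If \<open>x\<close> is dense, the sets \<open>F n\<close> together with \<open>G\<close> span a dense
  subspace.
\<close>

lemma gram_schmidt_complement:
  fixes G :: "'a::real_inner set" and x :: "nat \<Rightarrow> 'a"
  assumes "finite G"
  shows "\<exists>F :: nat \<Rightarrow> 'a set. \<forall>n.
     (finite (F n) \<and> (\<forall>f\<in>F n. \<forall>f'\<in>F n. f \<bullet> f' = (if f = f' then 1 else 0))
        \<and> (\<forall>f\<in>F n. \<forall>g\<in>G. g \<bullet> f = 0))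
     \<and> F n \<subseteq> F (Suc n) \<and> x n \<in> span (G \<union> F (Suc n))"
proof -
  have "\<exists>F :: nat \<Rightarrow> 'a set. \<forall>n.
     (finite (F n) \<and> (\<forall>f\<in>F n. \<forall>f'\<in>F n. f \<bullet> f' = (if f = f' then 1 else 0))
        \<and> (\<forall>f\<in>F n. \<forall>g\<in>G. g \<bullet> f = 0))
     \<and> (F n \<subseteq> F (Suc n) \<and> x n \<in> span (G \<union> F (Suc n)))"
  proof (rule dependent_nat_choice)
    show "\<exists>F :: 'a set. finite F \<and> (\<forall>f\<in>F. \<forall>f'\<in>F. f \<bullet> f' = (if f = f' then 1 else 0))
        \<and> (\<forall>f\<in>F. \<forall>g\<in>G. g \<bullet> f = 0)"
      by (rule exI[of _ "{}"]) simp
  next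
    fix F :: "'a set" and n :: nat
    assume F: "finite F \<and> (\<forall>f\<in>F. \<forall>f'\<in>F. f \<bullet> f' = (if f = f' then 1 else 0))
        \<and> (\<forall>f\<in>F. \<forall>g\<in>G. g \<bullet> f = 0)"
    obtain p where p: "p \<in> span (G \<union> F)" "\<And>s. s \<in> G \<union> F \<Longrightarrow> s \<bullet> (x n - p) = 0"
      using projection_on_finite_span[of "G \<union> F" "x n"] F assms by auto
    define r where "r = x n - p"
    note pr = p(2)[folded r_def]
    define F' where "F' = (if r = 0 then F else insert ((1 / norm r) *\<^sub>R r) F)"
    have "x n \<in> span (G \<union> F')"
    proof -
      have "p \<in> span (G \<union> F')" using p(1) by (rule rev_subsetD) (auto simp: F'_def intro!: span_mono)
      moreover have "r \<in> span (G \<union> F')"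
      proof (cases "r = 0")
        case False
        then have "norm r *\<^sub>R ((1 / norm r) *\<^sub>R r) \<in> span (G \<union> F')"
          by (intro span_scale span_base) (auto simp: F'_def)
        then show ?thesis using False by simp
      qed (simp add: span_zero)
      ultimately show ?thesis using span_add[of p _ r] by (simp add: r_def)
    qed
    moreover have "finite F' \<and> (\<forall>f\<in>F'. \<forall>f'\<in>F'. f \<bullet> f' = (if f = f' then 1 else 0))
        \<and> (\<forall>f\<in>F'. \<forall>g\<in>G. g \<bullet> f = 0)"
    proof (cases "r = 0")
      case True
      then show ?thesis using F by (simp add: F'_def)
    next
      case False
      let ?u = "(1 / norm r) *\<^sub>R r"
      have uu: "?u \<bullet> ?u = 1" using False
        by (simp add: dot_square_norm power2_eq_square)
      have us: "s \<bullet> ?u = 0 \<and> ?u \<bullet> s = 0" if "s \<in> G \<union> F" for s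
        using pr[OF that] by (simp add: inner_commute)
      have "?u \<notin> F" using us uu by force
      then show ?thesis using F us uu False unfolding F'_def
        by (auto split: if_splits)
    qed
    ultimately show "\<exists>F'. (finite F' \<and> (\<forall>f\<in>F'. \<forall>f'\<in>F'. f \<bullet> f' = (if f = f' then 1 else 0))
        \<and> (\<forall>f\<in>F'. \<forall>g\<in>G. g \<bullet> f = 0)) \<and> F \<subseteq> F' \<and> x n \<in> span (G \<union> F')"
      by (intro exI[of _ F']) (auto simp: F'_def)
  qed
  then show ?thesis by blast
qed

text \<open>
  The system consists of \<open>G\<close> with its dual vectors and an orthonormal set \<open>F\<close> in the orthogonal
  complement of \<open>G\<close>, which is dual to itself. Every partial sum of the expansion of \<open>h\<close> over a
  finite set \<open>Y \<supseteq> G\<close> is the orthogonal projection of \<open>h\<close> onto the span of \<open>Y\<close>. Therefore the partial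
  sums only improve as \<open>Y\<close> grows, and density of the span gives unconditional convergence.
\<close>

lemma biorthogonal_extension:
  fixes G :: "'a::real_inner set"
  assumes sep: "separable_space (euclidean :: 'a topology)" and "finite G" "independent G"
  shows "\<exists>X e. countable X \<and> G \<subseteq> X \<and> (\<forall>x\<in>X. \<forall>y\<in>X. x \<bullet> e y = (if x = y then 1 else 0))
    \<and> (\<forall>h. ((\<lambda>x. (x \<bullet> h) *\<^sub>R e x) has_sum h) X)"
proof -
  obtain x :: "nat \<Rightarrow> 'a" where x: "\<And>h e. 0 < e \<Longrightarrow> \<exists>n. dist (x n) h < e"
    using dense_sequence_in_subset[OF sep, of UNIV] by auto
  obtain F :: "nat \<Rightarrow> 'a set" where
    F: "\<And>n. finite (F n)" "\<And>n f f'. f \<in> F n \<Longrightarrow> f' \<in> F n \<Longrightarrow> f \<bullet> f' = (if f = f' then 1 else 0)"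
       "\<And>n f g. f \<in> F n \<Longrightarrow> g \<in> G \<Longrightarrow> g \<bullet> f = 0" "\<And>n. F n \<subseteq> F (Suc n)"
       "\<And>n. x n \<in> span (G \<union> F (Suc n))"
    using gram_schmidt_complement[OF assms(2), of x] by metis
  obtain d where d: "\<And>g. g \<in> G \<Longrightarrow> d g \<in> span G"
      "\<And>g g'. g \<in> G \<Longrightarrow> g' \<in> G \<Longrightarrow> g' \<bullet> d g = (if g' = g then 1 else 0)"
    using dual_vectors[OF assms(2,3)] by metis
  have Fmono: "F m \<subseteq> F n" if "m \<le> n" for m n
    using that by (induction rule: dec_induct) (use F(4) in blast)+
  define FF where "FF = (\<Union>n. F n)"
  have FF_orth: "f \<bullet> f' = (if f = f' then 1 else 0)" if ff: "f \<in> FF" "f' \<in> FF" for f f'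
  proof -
    obtain m n where "f \<in> F m" "f' \<in> F n" using ff by (auto simp: FF_def)
    then have "f \<in> F (max m n)" "f' \<in> F (max m n)"
      using Fmono[of m "max m n"] Fmono[of n "max m n"] by auto
    then show ?thesis by (rule F(2))
  qed
  have GF: "g \<bullet> f = 0" if "g \<in> G" "f \<in> FF" for g f using F(3) that by (auto simp: FF_def)
  have disj: "f \<notin> G" if "f \<in> FF" for f
    using GF[of f f] FF_orth[OF that that] that by auto
  define X where "X = G \<union> FF"
  define e where "e y = (if y \<in> G then d y else y)" for y
  have bi: "y \<bullet> e z = (if y = z then 1 else 0)" if "y \<in> X" "z \<in> X" for y z
  proof (cases "z \<in> G")
    case True
    show ?thesis
    proof (cases "y \<in> G")
      case False
      then have "y \<in> FF" using that by (auto simp: X_def)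
      then have "d z \<bullet> y = 0" using inner_span_eq_0[OF GF d(1)[OF True]] by blast
      then show ?thesis using True False by (auto simp: e_def inner_commute)
    qed (use True d(2) in \<open>auto simp: e_def\<close>)
  next
    case False
    then show ?thesis using that GF FF_orth disj by (auto simp: e_def X_def)
  qed
  have "((\<lambda>y. (y \<bullet> h) *\<^sub>R e y) has_sum h) X" for h
    unfolding has_sum_def tendsto_iff eventually_finite_subsets_at_top
  proof (intro allI impI)
    fix \<epsilon> :: real assume "0 < \<epsilon>"
    then obtain n where n: "dist (x n) h < \<epsilon>" using x by blast
    have "dist (\<Sum>y\<in>Y. (y \<bullet> h) *\<^sub>R e y) h < \<epsilon>"
      if Y: "finite Y" "G \<union> F (Suc n) \<subseteq> Y" "Y \<subseteq> X" for Y
    proof -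
      let ?p = "\<Sum>y\<in>Y. (y \<bullet> h) *\<^sub>R e y"
      have "e y \<in> span Y" if "y \<in> Y" for y
        using d(1)[of y] span_mono[of G Y] Y(2) that by (auto simp: e_def span_base)
      then have p: "?p \<in> span Y" by (auto intro!: span_sum span_scale)
      have "y \<bullet> (h - ?p) = 0" if y: "y \<in> Y" for y
      proof -
        have "y \<bullet> ?p = (\<Sum>z\<in>Y. if z = y then y \<bullet> h else 0)"
          unfolding inner_sum_right
        proof (rule sum.cong)
          fix z assume "z \<in> Y"
          then have "y \<bullet> e z = (if y = z then 1 else 0)" using bi[of y z] y Y(3) by blast
          then show "y \<bullet> ((z \<bullet> h) *\<^sub>R e z) = (if z = y then y \<bullet> h else 0)" by simp
        qed simp
        then show ?thesis using y Y(1) by (simp add: inner_diff_right)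
      qed
      moreover have "x n \<in> span Y" using F(5)[of n] span_mono[OF Y(2)] by blast
      ultimately have "norm (h - ?p) \<le> norm (h - x n)"
        using norm_diff_le_of_orthogonal[OF p] by blast
      then show ?thesis using n by (simp add: dist_norm norm_minus_commute)
    qed
    moreover have "finite (G \<union> F (Suc n))" "G \<union> F (Suc n) \<subseteq> X"
      using assms(2) F(1) by (auto simp: X_def FF_def)
    ultimately show "\<exists>Z. finite Z \<and> Z \<subseteq> X \<and> (\<forall>Y. finite Y \<and> Z \<subseteq> Y \<and> Y \<subseteq> X
        \<longrightarrow> dist (\<Sum>y\<in>Y. (y \<bullet> h) *\<^sub>R e y) h < \<epsilon>)" by blast
  qed
  moreover have "countable X"
    unfolding X_def FF_def using assms(2) F(1) by (auto simp: countable_finite)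
  ultimately show ?thesis using bi by (intro exI[of _ X] exI[of _ e]) (auto simp: X_def)
qed

lemma closed_dual_cone: "closed (dual_cone B)"
proof -
  have "dual_cone B = (\<Inter>b\<in>B. {h. 0 \<le> b \<bullet> h})" by (auto simp: dual_cone_def)
  moreover have "closed {h. 0 \<le> b \<bullet> h}" for b :: 'a
    by (intro closed_Collect_le continuous_intros)
  ultimately show ?thesis by auto
qed

lemma convex_cone_dual_cone: "convex_cone (dual_cone B)"
  unfolding convex_cone_iff dual_cone_def by (auto simp: inner_add_right)

text \<open>
  A cone cut out by finitely many linearly independent functionals is generated by a basis: the
  functionals are themselves coordinate functionals of a suitable unconditional basis.
\<close>

lemma generated_by_basis_dual_cone:
  fixes G :: "'a::real_inner set"
  assumes sep: "separable_space (euclidean :: 'a topology)" and "finite G" "independent G"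
  shows "generated_by_basis (dual_cone G) G"
proof -
  obtain X e where Xe: "countable X \<and> G \<subseteq> X
      \<and> (\<forall>x\<in>X. \<forall>y\<in>X. x \<bullet> e y = (if x = y then 1 else 0))
      \<and> (\<forall>h. ((\<lambda>x. (x \<bullet> h) *\<^sub>R e x) has_sum h) X)"
    using biorthogonal_extension[OF assms] by (elim exE)
  have X: "countable X" "G \<subseteq> X"
      "\<And>x y. x \<in> X \<Longrightarrow> y \<in> X \<Longrightarrow> x \<bullet> e y = (if x = y then 1 else 0)"
      "\<And>h. ((\<lambda>x. (x \<bullet> h) *\<^sub>R e x) has_sum h) X"
    using Xe by blast+
  \<comment> \<open>the index set required by the definition of a basis: it is finite exactly if the space has finite dimension\<close>
  define I where "I = (if finite X then {..<card X} else UNIV :: nat set)"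
  define b where "b = from_nat_into X"
  have b: "bij_betw b I X"
    using bij_betw_from_nat_into_finite[of X] bij_betw_from_nat_into[OF X(1)] by (simp add: I_def b_def)
  have bX: "b k \<in> X" if "k \<in> I" for k using b that by (auto simp: bij_betw_def)
  have b_eq: "b j = b k \<longleftrightarrow> j = k" if "j \<in> I" "k \<in> I" for j k
    using b that by (auto simp: bij_betw_def inj_on_def)
  have fin_iff: "(\<exists>B :: 'a set. finite B \<and> span B = UNIV) \<longleftrightarrow> finite X"
  proof
    assume "finite X"
    have "h \<in> span (e ` X)" for h
    proof -
      have "h = (\<Sum>x\<in>X. (x \<bullet> h) *\<^sub>R e x)"
        using X(4)[of h] \<open>finite X\<close> has_sum_unique has_sum_finite by blast
      also have "\<dots> \<in> span (e ` X)" by (intro span_sum span_scale span_base) auto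
      finally show ?thesis .
    qed
    then show "\<exists>B :: 'a set. finite B \<and> span B = UNIV" using \<open>finite X\<close> by (intro exI[of _ "e ` X"]) auto
  next
    assume "\<exists>B :: 'a set. finite B \<and> span B = UNIV"
    then obtain B :: "'a set" where B: "finite B" "span B = UNIV" by blast
    have "independent X"
    proof
      assume "dependent X"
      then obtain x where x: "x \<in> X" "x \<in> span (X - {x})" by (auto simp: dependent_def)
      have "x \<bullet> e x = 0" by (rule inner_span_eq_0[OF _ x(2)]) (use X(3) x(1) in auto)
      then show False using X(3)[OF x(1) x(1)] by simp
    qed
    then show "finite X" using independent_span_bound[OF B(1)] B(2) by blast
  qed
  have "unconditional_schauder_basis I b (\<lambda>k. e (b k))"
    unfolding unconditional_schauder_basis_def
  proof (intro conjI allI impI ballI)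
    show "if \<exists>B :: 'a set. finite B \<and> span B = UNIV then finite I else I = UNIV"
      unfolding fin_iff by (simp add: I_def)
    show "((\<lambda>k. (b k \<bullet> h) *\<^sub>R e (b k)) has_sum h) I" for h
      using X(4)[of h] has_sum_reindex_bij_betw[OF b, of "\<lambda>x. (x \<bullet> h) *\<^sub>R e x"] by simp
  next
    fix h c k assume h: "((\<lambda>k. c k *\<^sub>R e (b k)) has_sum h) I" and k: "k \<in> I"
    have "((\<lambda>j. b k \<bullet> (c j *\<^sub>R e (b j))) has_sum (b k \<bullet> h)) I"
      using has_sum_bounded_linear[OF bounded_linear_inner_right h] .
    moreover have "((\<lambda>j. b k \<bullet> (c j *\<^sub>R e (b j))) has_sum (c k)) I"
      by (rule has_sum_finite_neutralI[of "{k}"]) (use k X(3) bX b_eq in auto)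
    ultimately show "c k = b k \<bullet> h" using has_sum_unique by blast
  qed
  moreover have "G \<subseteq> (\<Union>k\<in>I. span {b k})"
  proof
    fix g assume "g \<in> G"
    then have "g \<in> b ` I" using X(2) b by (auto simp: bij_betw_def)
    then show "g \<in> (\<Union>k\<in>I. span {b k})" by (auto intro: span_base)
  qed
  moreover have "cone_with_generating_system (dual_cone G) G"
    unfolding cone_with_generating_system_def
    using closed_dual_cone convex_cone_dual_cone
    by (auto simp: dual_cone_def inner_commute)
  ultimately show ?thesis unfolding generated_by_basis_def by blast
qed

section \<open>Order and inner product in an abstract \<open>L\<^sup>2\<close>-space\<close>

lemma norm_mono_nonneg:
  fixes x y :: "'h::abstract_L2_space"
  assumes "0 \<le> x" "x \<le> y"
  shows "norm x \<le> norm y"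
proof (rule norm_lattice_mono)
  have "- x \<le> x" using assms(1) order_trans[of "- x" 0 x] by simp
  then have "lattice_abs x \<le> x" unfolding lattice_abs_def by simp
  also note assms(2)
  also have "y \<le> lattice_abs y" by (simp add: lattice_abs_def)
  finally show "lattice_abs x \<le> lattice_abs y" .
qed

text \<open>
  For positive \<open>x\<close> and \<open>y\<close> one has \<open>\<bar>x - y\<bar> \<le> x + y\<close>, hence \<open>\<parallel>x - y\<parallel> \<le> \<parallel>x + y\<parallel>\<close>, and the difference of
  the squares of these norms is \<open>4 * (x \<bullet> y)\<close>.
\<close>

lemma inner_nonneg:
  fixes x y :: "'h::abstract_L2_space"
  assumes "0 \<le> x" "0 \<le> y"
  shows "0 \<le> x \<bullet> y"
proof -
  have "x - y \<le> x + y" "- (x - y) \<le> x + y"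
    using assms add_mono[of "- y" y x x] add_mono[of "- x" x y y]
      order_trans[of "- y" 0 y] order_trans[of "- x" 0 x] by simp_all
  then have "lattice_abs (x - y) \<le> x + y" unfolding lattice_abs_def by (rule sup_least)
  also have "\<dots> \<le> lattice_abs (x + y)" by (simp add: lattice_abs_def)
  finally have "norm (x - y) \<le> norm (x + y)" by (rule norm_lattice_mono)
  then have "(norm (x - y))\<^sup>2 \<le> (norm (x + y))\<^sup>2" by (simp add: power_mono)
  then show ?thesis unfolding power2_norm_eq_inner by (simp add: algebra_simps inner_commute)
qed

lemma inner_mono:
  fixes x y z :: "'h::abstract_L2_space"
  assumes "x \<le> y" "0 \<le> z"
  shows "x \<bullet> z \<le> y \<bullet> z" "z \<bullet> x \<le> z \<bullet> y"
  using inner_nonneg[of "y - x" z] inner_nonneg[of z "y - x"] assms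
  by (simp_all add: inner_diff_left inner_diff_right)

lemma inner_eq_0_mono:
  fixes x y x' y' :: "'h::abstract_L2_space"
  assumes "x \<bullet> y = 0" "0 \<le> x'" "x' \<le> x" "0 \<le> y'" "y' \<le> y"
  shows "x' \<bullet> y' = 0"
proof -
  have "x' \<bullet> y' \<le> x \<bullet> y'" using assms by (intro inner_mono)
  also have "\<dots> \<le> x \<bullet> y" using assms by (intro inner_mono order_trans[of 0 x' x])
  finally show ?thesis using assms inner_nonneg[of x' y'] by simp
qed

text \<open>
  Orthogonality and disjointness of positive vectors agree. From here on disjointness is expressed by
  the inner product, which turns most lattice arguments into monotonicity of the inner product.
\<close>

lemma inner_eq_0_iff_inf:
  fixes x y :: "'h::abstract_L2_space"
  assumes "0 \<le> x" "0 \<le> y"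
  shows "x \<bullet> y = 0 \<longleftrightarrow> inf x y = 0"
proof
  assume "x \<bullet> y = 0"
  then have "inf x y \<bullet> inf x y = 0" by (rule inner_eq_0_mono) (use assms in auto)
  then show "inf x y = 0" by simp
next
  assume "inf x y = 0"
  from norm_add_disjoint[OF assms this] show "x \<bullet> y = 0"
    unfolding power2_norm_eq_inner by (simp add: algebra_simps inner_commute)
qed

text \<open>
  The two parts are \<open>m = sup x 0\<close> and \<open>n = m - x\<close>. They are disjoint: if \<open>z = inf m n\<close>, then \<open>m - z\<close>
  is still an upper bound of \<open>x\<close> and \<open>0\<close>, so \<open>z \<le> 0\<close>.
\<close>

lemma jordan_decomposition:
  fixes x :: "'h::abstract_L2_space"
  obtains m n where "0 \<le> m" "0 \<le> n" "x = m - n" "m \<bullet> n = 0"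
proof -
  define m where "m = sup x 0"
  define n where "n = m - x"
  have mn: "0 \<le> m" "0 \<le> n" by (simp_all add: m_def n_def)
  let ?z = "inf m n"
  have "?z \<le> m" "?z \<le> m - x" by (simp_all add: n_def)
  then have "0 \<le> m - ?z" "x \<le> m - ?z" by (simp_all add: algebra_simps)
  then have "m \<le> m - ?z" unfolding m_def by (intro sup_least)
  then have "?z \<le> 0" by simp
  then have "?z = 0" using mn by (intro antisym) simp_all
  then have "m \<bullet> n = 0" using inner_eq_0_iff_inf[OF mn] by simp
  with mn show ?thesis by (intro that) (simp_all add: n_def)
qed

text \<open>
  Testing an element \<open>x = m - n\<close> of the dual cone with its own negative part \<open>n\<close> gives
  \<open>0 \<le> n \<bullet> x = - (n \<bullet> n)\<close>. Self-duality also yields that the positive cone is closed, as every dual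
  cone is.
\<close>

lemma dual_positive_cone: "dual_cone positive_cone = (positive_cone :: 'h::abstract_L2_space set)"
proof
  show "positive_cone \<subseteq> dual_cone (positive_cone :: 'h set)"
    by (auto simp: dual_cone_def positive_cone_def inner_nonneg)
  show "dual_cone positive_cone \<subseteq> (positive_cone :: 'h set)"
  proof
    fix x :: 'h assume x: "x \<in> dual_cone positive_cone"
    obtain m n where mn: "0 \<le> m" "0 \<le> n" "x = m - n" "m \<bullet> n = 0" by (rule jordan_decomposition)
    have "0 \<le> n \<bullet> x" using x mn(2) by (auto simp: dual_cone_def positive_cone_def)
    then have "n \<bullet> n \<le> 0" using mn(3,4) by (simp add: inner_diff_right inner_commute)
    then have "n = 0" using inner_gt_zero_iff[of n] by linarith
    then show "x \<in> positive_cone" using mn by (simp add: positive_cone_def)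
  qed
qed

lemma closed_positive_cone: "closed (positive_cone :: 'h::abstract_L2_space set)"
  by (metis closed_dual_cone dual_positive_cone)

lemma LIMSEQ_lower_bound:
  fixes X :: "nat \<Rightarrow> 'h::abstract_L2_space"
  assumes "X \<longlonglongrightarrow> x" "\<And>n. n \<ge> N \<Longrightarrow> y \<le> X n"
  shows "y \<le> x"
proof -
  have "(\<lambda>n. X (n + N) - y) \<longlonglongrightarrow> x - y" using LIMSEQ_ignore_initial_segment[OF assms(1)] by (intro tendsto_intros)
  moreover have "X (n + N) - y \<in> positive_cone" for n
    using assms(2) by (simp add: positive_cone_def)
  ultimately have "x - y \<in> positive_cone"
    using closed_sequentially[OF closed_positive_cone, of "\<lambda>n. X (n + N) - y"] by blast
  then show ?thesis by (simp add: positive_cone_def)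
qed

lemma LIMSEQ_upper_bound:
  fixes X :: "nat \<Rightarrow> 'h::abstract_L2_space"
  assumes "X \<longlonglongrightarrow> x" "\<And>n. X n \<le> y"
  shows "x \<le> y"
  using LIMSEQ_lower_bound[OF tendsto_minus[OF assms(1)], of 0 "- y"] assms(2) by simp

section \<open>Components of a positive vector\<close>

text \<open>
  If \<open>e\<close> is a positive function on a measure space, its components are the restrictions of \<open>e\<close> to
  measurable subsets. The condition \<open>inf p (e - p) = 0\<close> is stated in its equivalent form with the
  inner product.
\<close>

definition lattice_components :: "'h::abstract_L2_space \<Rightarrow> 'h set"
  where "lattice_components e = {p. 0 \<le> p \<and> p \<le> e \<and> p \<bullet> (e - p) = 0}"

text \<open>
  Since increments of the sequence have nonnegative inner product with its earlier terms,
  \<open>\<parallel>X n - X m\<parallel>\<^sup>2 \<le> \<parallel>X n\<parallel>\<^sup>2 - \<parallel>X m\<parallel>\<^sup>2\<close> for \<open>m \<le> n\<close>, and the squared norms converge.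
\<close>

lemma increasing_convergent:
  fixes X :: "nat \<Rightarrow> 'h::abstract_L2_space"
  assumes "\<And>n. 0 \<le> X n" "\<And>n. X n \<le> X (Suc n)" "\<And>n. X n \<le> y"
  shows "convergent X"
proof -
  have mono: "X m \<le> X n" if "m \<le> n" for m n using lift_Suc_mono_le[of X m n] assms(2) that by blast
  have pyth: "(norm (X n - X m))\<^sup>2 \<le> (norm (X n))\<^sup>2 - (norm (X m))\<^sup>2" if "m \<le> n" for m n
    using inner_nonneg[of "X m" "X n - X m"] assms(1)[of m] mono[OF that]
    unfolding power2_norm_eq_inner by (simp add: algebra_simps inner_commute)
  have bound: "(norm (X n))\<^sup>2 \<le> (norm y)\<^sup>2" for n
    using norm_mono_nonneg[OF assms(1,3)] by (simp add: power_mono)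
  have "incseq (\<lambda>n. (norm (X n))\<^sup>2)"
    using norm_mono_nonneg[OF assms(1,2)] by (intro incseq_SucI) (simp add: power_mono)
  then have "convergent (\<lambda>n. (norm (X n))\<^sup>2)"
    using incseq_convergent[of _ "(norm y)\<^sup>2"] bound by (metis convergentI)
  then have cau: "Cauchy (\<lambda>n. (norm (X n))\<^sup>2)" by (simp add: Cauchy_convergent_iff)
  have "Cauchy X"
  proof (rule metric_CauchyI)
    fix e :: real assume "0 < e"
    then obtain N where N: "\<And>m n. m \<ge> N \<Longrightarrow> n \<ge> N \<Longrightarrow> \<bar>(norm (X m))\<^sup>2 - (norm (X n))\<^sup>2\<bar> < e\<^sup>2"
      using metric_CauchyD[OF cau, of "e\<^sup>2"] by (auto simp: dist_real_def)
    have *: "dist (X n) (X m) < e" if "m \<ge> N" "n \<ge> N" "m \<le> n" for m n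
    proof -
      have "(norm (X n - X m))\<^sup>2 < e\<^sup>2"
        using N[OF that(1,2)] pyth[OF that(3)] by linarith
      then show ?thesis using \<open>0 < e\<close> by (simp add: dist_norm power_less_imp_less_base)
    qed
    show "\<exists>M. \<forall>m\<ge>M. \<forall>n\<ge>M. dist (X m) (X n) < e"
      using * by (metis dist_commute nle_le)
  qed
  then show ?thesis by (simp add: Cauchy_convergent)
qed

text \<open>
  The vector \<open>p\<close> is the projection of \<open>v\<close> onto the band generated by \<open>f\<close>, the limit of
  \<open>inf v (n *\<^sub>R f)\<close>. For functions it is \<open>v\<close> restricted to the set where \<open>f\<close> is positive. All
  nontrivial components below arise in this way.
\<close>

lemma band_component:
  fixes v f :: "'h::abstract_L2_space"
  assumes v: "0 \<le> v" and f: "0 \<le> f"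
  obtains p where "p \<in> lattice_components v" "(v - p) \<bullet> f = 0"
    "\<And>g. 0 \<le> g \<Longrightarrow> f \<bullet> g = 0 \<Longrightarrow> p \<bullet> g = 0"
proof -
  define X where "X n = inf v (real n *\<^sub>R f)" for n
  have nf: "0 \<le> real n *\<^sub>R f" for n using f by (simp add: scaleR_nonneg_nonneg)
  have X0: "0 \<le> X n" for n using v nf by (simp add: X_def)
  have Xv: "X n \<le> v" for n by (simp add: X_def)
  have XSuc: "X n \<le> X (Suc n)" for n
  proof -
    have "real n *\<^sub>R f \<le> real (Suc n) *\<^sub>R f" using f by (intro scaleR_right_mono) auto
    then show ?thesis unfolding X_def by (intro inf_mono order_refl)
  qed
  obtain p where p: "X \<longlonglongrightarrow> p"
    using increasing_convergent[of X v] X0 XSuc Xv by (auto simp: convergent_def)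
  have Xmono: "X m \<le> X n" if "m \<le> n" for m n using lift_Suc_mono_le[of X m n] XSuc that by blast
  have Xp: "X n \<le> p" for n by (rule LIMSEQ_lower_bound[OF p Xmono])
  have pv: "p \<le> v" by (rule LIMSEQ_upper_bound[OF p Xv])
  have p0: "0 \<le> p" using X0[of 0] Xp[of 0] by (rule order_trans)
  have lim_orth: "p \<bullet> g = 0" if "\<And>n. X n \<bullet> g = 0" for g
  proof -
    have "(\<lambda>n. X n \<bullet> g) \<longlonglongrightarrow> p \<bullet> g" by (intro tendsto_intros p)
    then show ?thesis using that by (simp add: LIMSEQ_const_iff)
  qed
  have band: "p \<bullet> g = 0" if g: "0 \<le> g" "f \<bullet> g = 0" for g
  proof (rule lim_orth)
    fix n
    have "(real n *\<^sub>R f) \<bullet> g = 0" using g by simp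
    then show "X n \<bullet> g = 0" by (rule inner_eq_0_mono) (use X0 g in \<open>auto simp: X_def\<close>)
  qed
  \<comment> \<open>adding the part of \<open>v - p\<close> below \<open>f\<close> to \<open>X n\<close> leads at most to \<open>X (Suc n)\<close>\<close>
  let ?z = "inf (v - p) f"
  have "X n + ?z \<le> p" for n
  proof -
    have "X n + ?z \<le> p + (v - p)" by (intro add_mono Xp inf_le1)
    moreover have "X n + ?z \<le> real n *\<^sub>R f + f" by (intro add_mono) (auto simp: X_def)
    ultimately have "X n + ?z \<le> X (Suc n)"
      unfolding X_def by (intro inf_greatest) (auto simp: algebra_simps)
    also note Xp
    finally show ?thesis .
  qed
  moreover have "(\<lambda>n. X n + ?z) \<longlonglongrightarrow> p + ?z" by (intro tendsto_intros p)
  ultimately have "p + ?z \<le> p" using LIMSEQ_upper_bound by blast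
  then have "?z = 0" using f pv by (intro antisym) simp_all
  then have vp: "(v - p) \<bullet> f = 0" using inner_eq_0_iff_inf[of "v - p" f] f pv by simp
  have "p \<bullet> (v - p) = 0" using band[of "v - p"] vp pv by (simp add: inner_commute)
  then show ?thesis using that[of p] p0 pv vp band by (simp add: lattice_components_def)
qed

lemma component_trans:
  assumes "p \<in> lattice_components v" "v \<in> lattice_components e"
  shows "p \<in> lattice_components (e :: 'h::abstract_L2_space)"
proof -
  have p: "0 \<le> p" "p \<le> v" "p \<bullet> (v - p) = 0" and v: "0 \<le> v" "v \<le> e" "v \<bullet> (e - v) = 0"
    using assms by (auto simp: lattice_components_def)
  have "p \<bullet> (e - v) = 0" by (rule inner_eq_0_mono[OF v(3)]) (use p v in auto)
  moreover have "p \<bullet> (e - p) = p \<bullet> (e - v) + p \<bullet> (v - p)" by (simp add: inner_diff_right)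
  ultimately show ?thesis using p v by (auto simp: lattice_components_def)
qed

text \<open>
  The basic estimate is \<open>x + p - e \<le> inf x p\<close>. For sets it says that the complement of an
  intersection is covered by the two complements, and it reduces all orthogonality claims to those for
  \<open>x\<close> and \<open>p\<close>.
\<close>

lemma component_inf:
  assumes "x \<in> lattice_components e" "p \<in> lattice_components e"
  shows "inf x p \<in> lattice_components (e :: 'h::abstract_L2_space)"
    and "x - inf x p \<in> lattice_components e"
    and "(x - inf x p) \<bullet> p = 0"
proof -
  have x: "0 \<le> x" "x \<le> e" "x \<bullet> (e - x) = 0" and p: "0 \<le> p" "p \<le> e" "p \<bullet> (e - p) = 0"
    using assms by (auto simp: lattice_components_def)
  have le: "x + p - e \<le> inf x p" 
    using add_left_mono[of "p - e" 0 x] add_left_mono[of "x - e" 0 p] x p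
    by (intro inf_greatest) (simp_all add: algebra_simps)
  have i: "0 \<le> inf x p" "inf x p \<le> x" "inf x p \<le> p" "inf x p \<le> e"
    using x p by (auto intro: le_infI1)
  have ix: "inf x p \<bullet> (e - x) = 0" by (rule inner_eq_0_mono[OF x(3)]) (use i x in auto)
  have ip: "inf x p \<bullet> (e - p) = 0" by (rule inner_eq_0_mono[OF p(3)]) (use i p in auto)
  have "e - inf x p \<le> (e - x) + (e - p)" using diff_left_mono[OF le, of e] by (simp add: algebra_simps)
  then have "inf x p \<bullet> (e - inf x p) \<le> inf x p \<bullet> ((e - x) + (e - p))"
    using i(1) by (rule inner_mono)
  then have 1: "inf x p \<bullet> (e - inf x p) = 0"
    using ix ip inner_nonneg[of "inf x p" "e - inf x p"] i by (simp add: inner_add_right)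
  then show "inf x p \<in> lattice_components e" using i by (simp add: lattice_components_def)
  have "p \<bullet> (x - inf x p) = 0"
  proof (rule inner_eq_0_mono[OF p(3)])
    show "x - inf x p \<le> e - p" using diff_left_mono[OF le, of x] by (simp add: algebra_simps)
  qed (use i p in auto)
  then show xp: "(x - inf x p) \<bullet> p = 0" by (simp add: inner_commute)
  have "(x - inf x p) \<bullet> (e - x) = 0" by (rule inner_eq_0_mono[OF x(3)]) (use i x in auto)
  moreover have "(x - inf x p) \<bullet> inf x p = 0" by (rule inner_eq_0_mono[OF xp]) (use i in auto)
  moreover have "e - (x - inf x p) = (e - x) + inf x p" by simp
  ultimately have "(x - inf x p) \<bullet> (e - (x - inf x p)) = 0" by (metis add_0 inner_add_right)
  moreover have "x - inf x p \<le> e"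
    using order_trans[of "x - inf x p" x e] i x by simp
  ultimately show "x - inf x p \<in> lattice_components e" using i by (simp add: lattice_components_def)
qed

text \<open>
  The components of \<open>e\<close> form a Boolean algebra, and finitely many of them are unions of the cells of a
  partition. A new component \<open>p\<close> cuts every cell \<open>x\<close> into \<open>inf x p\<close> and \<open>x - inf x p\<close>. During the
  induction the cells add up to \<open>e\<close>, which guarantees that the pieces inside \<open>p\<close> exhaust \<open>p\<close>; cells
  that are \<open>0\<close> are tolerated and removed at the end.
\<close>

lemma common_refinement:
  fixes e :: "'h::abstract_L2_space"
  assumes "finite W" "W \<subseteq> lattice_components e" and e: "0 \<le> e"
  shows "\<exists>V. finite V \<and> V \<subseteq> lattice_components e - {0} \<and> pairwise orthogonal V \<and> W \<subseteq> span V"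
proof -
  have "\<exists>V. finite V \<and> V \<subseteq> lattice_components e \<and> pairwise orthogonal V \<and> (\<Sum>x\<in>V. x) = e \<and> W \<subseteq> span V"
    using assms(1,2)
  proof (induction W rule: finite_induct)
    case empty
    show ?case using e by (intro exI[of _ "{e}"]) (auto simp: lattice_components_def)
  next
    case (insert p W)
    then obtain V where V: "finite V" "V \<subseteq> lattice_components e" "pairwise orthogonal V"
        "(\<Sum>x\<in>V. x) = e" "W \<subseteq> span V" by auto
    have p: "p \<in> lattice_components e" "p \<le> e" "0 \<le> p" using insert.prems by (auto simp: lattice_components_def)
    have V0: "0 \<le> x" if "x \<in> V" for x using V(2) that by (auto simp: lattice_components_def)
    define A where "A = (\<lambda>x. inf x p) ` V"
    define B where "B = (\<lambda>x. x - inf x p) ` V"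
    note ci = component_inf[OF subsetD[OF V(2)] p(1)]
    have i: "0 \<le> inf x p" "inf x p \<le> x" "inf x p \<le> p" "0 \<le> x - inf x p" "x - inf x p \<le> x"
      if "x \<in> V" for x using V0[OF that] p by auto
    have AB: "a \<bullet> b = 0" if "a \<in> A" "b \<in> B" for a b
    proof -
      obtain x y where xy: "x \<in> V" "a = inf x p" "y \<in> V" "b = y - inf y p"
        using \<open>a \<in> A\<close> \<open>b \<in> B\<close> by (auto simp: A_def B_def)
      have "(y - inf y p) \<bullet> inf x p = 0"
        by (rule inner_eq_0_mono[OF ci(3)[OF xy(3)]]) (use i xy in auto)
      then show ?thesis by (simp add: xy inner_commute)
    qed
    have orth_sub: "x' \<bullet> y' = 0"
      if "x \<in> V" "y \<in> V" "x \<noteq> y" "0 \<le> x'" "x' \<le> x" "0 \<le> y'" "y' \<le> y" for x y x' y'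
    proof -
      have "x \<bullet> y = 0" using V(3) that by (auto simp: pairwise_def orthogonal_def)
      then show ?thesis by (rule inner_eq_0_mono) (use that in auto)
    qed
    have AA: "a \<bullet> b = 0" if ab: "a \<in> A" "b \<in> A" "a \<noteq> b" for a b
    proof -
      obtain x y where "x \<in> V" "a = inf x p" "y \<in> V" "b = inf y p" using ab by (auto simp: A_def)
      then show ?thesis using ab(3) orth_sub[of x y a b] i(1,2)[of x] i(1,2)[of y] by auto
    qed
    have BB: "a \<bullet> b = 0" if ab: "a \<in> B" "b \<in> B" "a \<noteq> b" for a b
    proof -
      obtain x y where "x \<in> V" "a = x - inf x p" "y \<in> V" "b = y - inf y p" using ab by (auto simp: B_def)
      then show ?thesis using ab(3) orth_sub[of x y a b] i(4,5)[of x] i(4,5)[of y] by auto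
    qed
    have orth: "pairwise orthogonal (A \<union> B)"
      unfolding pairwise_def orthogonal_def
    proof (intro ballI impI)
      fix a b assume "a \<in> A \<union> B" "b \<in> A \<union> B" "a \<noteq> b"
      then show "a \<bullet> b = 0"
        using AA[of a b] BB[of a b] AB[of a b] AB[of b a] by (auto simp: inner_commute)
    qed
    have sumA: "(\<Sum>a\<in>A. a) = (\<Sum>x\<in>V. inf x p)"
      unfolding A_def
    proof (subst sum.reindex_nontrivial[OF V(1)])
      fix x y assume xy: "x \<in> V" "y \<in> V" "x \<noteq> y" "inf x p = inf y p"
      then have "inf x p \<bullet> inf y p = 0" using i(1,2) by (intro orth_sub[OF xy(1-3)])
      then have "inf x p \<bullet> inf x p = 0" using xy(4) by simp
      then show "inf x p = 0" by simp
    qed simp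
    have sumB: "(\<Sum>b\<in>B. b) = (\<Sum>x\<in>V. x - inf x p)"
      unfolding B_def
    proof (subst sum.reindex_nontrivial[OF V(1)])
      fix x y assume xy: "x \<in> V" "y \<in> V" "x \<noteq> y" "x - inf x p = y - inf y p"
      then have "(x - inf x p) \<bullet> (y - inf y p) = 0" using i(4,5) by (intro orth_sub[OF xy(1-3)])
      then have "(x - inf x p) \<bullet> (x - inf x p) = 0" using xy(4) by metis
      then show "x - inf x p = 0" by simp
    qed simp
    have "(\<Sum>x\<in>A \<union> B. x) = (\<Sum>x\<in>A. x) + (\<Sum>x\<in>B. x)"
    proof (rule sum.union_inter_neutral)
      show "finite A" "finite B" using V(1) by (auto simp: A_def B_def)
      show "\<forall>x\<in>A \<inter> B. x = 0" using AB inner_eq_zero_iff by blast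
    qed
    also have "\<dots> = e" by (simp add: sumA sumB sum_subtractf V(4))
    finally have sum: "(\<Sum>x\<in>A \<union> B. x) = e" .
    have comp: "A \<union> B \<subseteq> lattice_components e" using ci(1,2) by (auto simp: A_def B_def)
    have "x \<in> span (A \<union> B)" if "x \<in> V" for x
    proof -
      have "inf x p + (x - inf x p) \<in> span (A \<union> B)"
        using that by (intro span_add) (auto simp: A_def B_def intro: span_base)
      then show ?thesis by simp
    qed
    then have "span V \<subseteq> span (A \<union> B)" by (intro span_minimal) auto
    then have W: "W \<subseteq> span (A \<union> B)" using V(5) by blast
    have "p \<in> span A"
    proof -
      \<comment> \<open>the residual is orthogonal to \<open>e - p\<close> and to the pieces outside \<open>p\<close>, but it is their difference\<close>
      let ?r = "p - (\<Sum>x\<in>V. inf x p)"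
      have s0: "(\<Sum>b\<in>B. b) \<bullet> p = 0"
        unfolding inner_sum_left B_def using ci(3) by (intro sum.neutral) auto
      have er: "e = (\<Sum>x\<in>V. inf x p) + (\<Sum>b\<in>B. b)" by (simp add: sumB sum_subtractf V(4))
      have "(\<Sum>x\<in>V. inf x p) \<bullet> (e - p) = 0"
        unfolding inner_sum_left
      proof (intro sum.neutral ballI)
        fix x assume "x \<in> V"
        have "p \<bullet> (e - p) = 0" using p by (simp add: lattice_components_def)
        then show "inf x p \<bullet> (e - p) = 0"
          by (rule inner_eq_0_mono) (use i[OF \<open>x \<in> V\<close>] p in auto)
      qed
      then have 1: "?r \<bullet> (e - p) = 0" using p(1) by (simp add: inner_diff_left lattice_components_def)
      have "(\<Sum>a\<in>A. a) \<bullet> (\<Sum>b\<in>B. b) = 0"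
        unfolding inner_sum_left inner_sum_right using AB by (intro sum.neutral ballI) blast
      then have 2: "?r \<bullet> (\<Sum>b\<in>B. b) = 0"
        using s0 unfolding sumA inner_diff_left by (simp add: inner_commute)
      have "?r = (\<Sum>b\<in>B. b) - (e - p)" unfolding er by simp
      then have "?r \<bullet> ?r = ?r \<bullet> (\<Sum>b\<in>B. b) - ?r \<bullet> (e - p)" by (metis inner_diff_right)
      then have "?r \<bullet> ?r = 0" unfolding 1 2 by simp
      then have "?r = 0" unfolding inner_eq_zero_iff .
      then have "p = (\<Sum>a\<in>A. a)" unfolding sumA by simp
      then show ?thesis by (auto intro: span_sum span_base)
    qed
    then have "p \<in> span (A \<union> B)" using span_mono[of A "A \<union> B"] by auto
    with W have "insert p W \<subseteq> span (A \<union> B)" by (rule insert_subsetI[rotated])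
    moreover have "finite (A \<union> B)" using V(1) by (simp add: A_def B_def)
    ultimately show ?case using comp orth sum by (intro exI[of _ "A \<union> B"]) simp
  qed
  then obtain V where V: "finite V" "V \<subseteq> lattice_components e" "pairwise orthogonal V" "W \<subseteq> span V" by blast
  have "W \<subseteq> span (V - {0})" using V(4) by simp
  moreover have "pairwise orthogonal (V - {0})" using V(3) by (rule pairwise_subset) auto
  ultimately show ?thesis using V by (intro exI[of _ "V - {0}"]) auto
qed

section \<open>Atoms and the diffuse part\<close>

text \<open>
  Normalised atoms of the lattice; in a function space, normalised indicators of atoms of the
  measure.
\<close>

definition atoms :: "'h::abstract_L2_space set"
  where "atoms = {a. 0 \<le> a \<and> norm a = 1 \<and> (\<forall>x. 0 \<le> x \<longrightarrow> x \<le> a \<longrightarrow> (\<exists>t. x = t *\<^sub>R a))}"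

definition diffuse :: "'h::abstract_L2_space set"
  where "diffuse = {x. \<forall>a\<in>atoms. a \<bullet> x = 0}"

lemma below_atom:
  assumes "a \<in> atoms" "0 \<le> x" "x \<le> a"
  shows "\<exists>t. x = t *\<^sub>R a"
  using assms by (auto simp: atoms_def)

text \<open>
  The infimum of two atoms is a multiple of both. If it is not \<open>0\<close>, the atoms are proportional, and
  being positive unit vectors they coincide.
\<close>

lemma atoms_orthogonal: "pairwise orthogonal (atoms :: 'h::abstract_L2_space set)"
  unfolding pairwise_def orthogonal_def
proof (intro ballI impI, rule ccontr)
  fix a b :: 'h assume ab: "a \<in> atoms" "b \<in> atoms" "a \<noteq> b" "a \<bullet> b \<noteq> 0"
  have a: "0 \<le> a" "norm a = 1" and b: "0 \<le> b" "norm b = 1" using ab by (auto simp: atoms_def)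
  obtain s t where st: "inf a b = s *\<^sub>R a" "inf a b = t *\<^sub>R b"
    using below_atom[OF ab(1) _ inf_le1, of b] below_atom[OF ab(2) _ inf_le2, of a] a(1) b(1)
    by (metis inf_greatest)
  have "inf a b \<noteq> 0" using inner_eq_0_iff_inf[OF a(1) b(1)] ab(4) by simp
  then have "s \<noteq> 0" using st by auto
  have "(1 / s) *\<^sub>R (s *\<^sub>R a) = (1 / s) *\<^sub>R (t *\<^sub>R b)" using st by simp
  then have c: "a = (t / s) *\<^sub>R b" using \<open>s \<noteq> 0\<close> by simp
  then have "\<bar>t / s\<bar> = 1" using a b by (metis mult.right_neutral norm_scaleR)
  then consider "t / s = 1" | "t / s = -1" by linarith
  then show False
  proof cases
    case 1
    then show ?thesis using c ab(3) by simp
  next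
    case 2
    then have "a \<le> 0" using c b(1) by simp
    then show ?thesis using a by (metis antisym norm_zero zero_neq_one)
  qed
qed

lemma countable_atoms:
  assumes "separable_space (euclidean :: 'h::abstract_L2_space topology)"
  shows "countable (atoms :: 'h set)"
  using orthonormal_countable[OF assms atoms_orthogonal] by (auto simp: atoms_def)

lemma diffuse_below:
  assumes "v \<in> diffuse" "0 \<le> p" "p \<le> (v :: 'h::abstract_L2_space)"
  shows "p \<in> diffuse"
  unfolding diffuse_def
proof (intro CollectI ballI)
  fix a :: 'h assume a: "a \<in> atoms"
  have "a \<bullet> v = 0" using assms(1) a by (auto simp: diffuse_def)
  then show "a \<bullet> p = 0" by (rule inner_eq_0_mono) (use a assms in \<open>auto simp: atoms_def\<close>)
qed

text \<open>
  One of the disjoint parts \<open>m\<close> and \<open>n\<close> is disjoint from a given atom, because an atom cannot be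
  shared, and then both are since \<open>m - n\<close> is orthogonal to the atom.
\<close>

lemma diffuse_jordan:
  fixes m n :: "'h::abstract_L2_space"
  assumes "m - n \<in> diffuse" "0 \<le> m" "0 \<le> n" "m \<bullet> n = 0"
  shows "m \<in> diffuse"
  unfolding diffuse_def
proof (intro CollectI ballI)
  fix a :: 'h assume a: "a \<in> atoms"
  then have a0: "0 \<le> a" by (simp add: atoms_def)
  have eq: "a \<bullet> m = a \<bullet> n" using assms(1) a by (auto simp: diffuse_def inner_diff_right)
  obtain s t where st: "inf m a = s *\<^sub>R a" "inf n a = t *\<^sub>R a"
    using below_atom[OF a _ inf_le2, of m] below_atom[OF a _ inf_le2, of n] a0 assms(2,3)
    by (metis inf_greatest)
  have "inf m a \<bullet> inf n a = 0" by (rule inner_eq_0_mono[OF assms(4)]) (use assms a0 in auto)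
  then have "s = 0 \<or> t = 0 \<or> a = 0" using st by auto
  then have "inf a m = 0 \<or> inf a n = 0" using st by (auto simp: inf_commute)
  then show "a \<bullet> m = 0" using eq inner_eq_0_iff_inf[OF a0] assms by metis
qed

text \<open>
  If \<open>v\<close> had no proper component, then \<open>v\<close> would be proportional to an atom. Given \<open>0 \<le> x \<le> v\<close>, let
  \<open>y = x - t *\<^sub>R v\<close> with \<open>t\<close> chosen such that \<open>y \<bullet> v = 0\<close>. The band of the positive part of \<open>y\<close> contains
  either nothing or all of \<open>v\<close>, so one of the two parts of \<open>y\<close> is orthogonal to \<open>v\<close>, hence both are, and
  \<open>y = 0\<close>.
\<close>

lemma diffuse_split:
  fixes v :: "'h::abstract_L2_space"
  assumes "v \<in> diffuse" "0 \<le> v" "v \<noteq> 0"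
  shows "\<exists>w\<in>lattice_components v. w \<noteq> 0 \<and> w \<noteq> v"
proof (rule ccontr)
  assume "\<not> ?thesis"
  then have triv: "w = 0 \<or> w = v" if "w \<in> lattice_components v" for w using that by blast
  have multiple: "\<exists>t. x = t *\<^sub>R v" if x: "0 \<le> x" "x \<le> v" for x
  proof -
    define t where "t = (x \<bullet> v) / (v \<bullet> v)"
    have t: "0 \<le> t" using inner_nonneg[OF x(1) assms(2)] by (simp add: t_def)
    define y where "y = x - t *\<^sub>R v"
    have yv: "y \<bullet> v = 0" using assms(3) by (simp add: y_def t_def inner_diff_left)
    obtain m n where mn: "0 \<le> m" "0 \<le> n" "y = m - n" "m \<bullet> n = 0" by (rule jordan_decomposition)
    obtain p where p: "p \<in> lattice_components v" "(v - p) \<bullet> m = 0"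
        "\<And>g. 0 \<le> g \<Longrightarrow> m \<bullet> g = 0 \<Longrightarrow> p \<bullet> g = 0"
      using band_component[OF assms(2) mn(1)] by blast
    have eq: "v \<bullet> m = v \<bullet> n" using yv by (simp add: mn(3) inner_diff_left inner_commute[of v])
    have "v \<bullet> m = 0"
      using triv[OF p(1)] p(2) p(3)[OF mn(2,4)] eq by auto
    then have vm: "m \<bullet> v = 0" and vn: "n \<bullet> v = 0" using eq by (simp_all add: inner_commute)
    have mx: "m \<bullet> x = 0" by (rule inner_eq_0_mono[OF vm]) (use mn x in auto)
    have nx: "n \<bullet> x = 0" by (rule inner_eq_0_mono[OF vn]) (use mn x in auto)
    have "m \<bullet> y = 0" "n \<bullet> y = 0" using vm vn mx nx by (simp_all add: y_def inner_diff_right)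
    then have "y \<bullet> y = 0" unfolding mn(3) by (simp add: inner_diff_left)
    then show ?thesis by (intro exI[of _ t]) (simp add: y_def)
  qed
  define a where "a = (1 / norm v) *\<^sub>R v"
  have nv: "0 < norm v" using assms(3) by simp
  have "\<exists>t. x = t *\<^sub>R a" if x: "0 \<le> x" "x \<le> a" for x
  proof -
    have "norm v *\<^sub>R x \<le> norm v *\<^sub>R a" using x nv by (intro scaleR_left_mono) auto
    moreover have "norm v *\<^sub>R a = v" using nv by (simp add: a_def)
    ultimately have "norm v *\<^sub>R x \<le> v" by simp
    moreover have "0 \<le> norm v *\<^sub>R x" using x(1) by (simp add: scaleR_nonneg_nonneg)
    ultimately obtain t where t: "norm v *\<^sub>R x = t *\<^sub>R v" using multiple by blast
    have "x = (1 / norm v) *\<^sub>R (norm v *\<^sub>R x)" using nv by simp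
    also have "\<dots> = t *\<^sub>R a" unfolding t by (simp add: a_def)
    finally show ?thesis by blast
  qed
  then have "a \<in> atoms" using nv assms(2) by (simp add: atoms_def a_def scaleR_nonneg_nonneg)
  then have "a \<bullet> v = 0" using assms(1) by (auto simp: diffuse_def)
  then show False using assms(3) by (simp add: a_def)
qed

lemma inner_eq_0_of_dense:
  fixes q :: "nat \<Rightarrow> 'a::real_inner"
  assumes "\<And>n. q n \<bullet> x = 0" "\<And>\<epsilon>. 0 < \<epsilon> \<Longrightarrow> \<exists>n. dist (q n) p < \<epsilon>"
  shows "p \<bullet> x = 0"
proof (rule ccontr)
  assume ne: "p \<bullet> x \<noteq> 0"
  then have x: "0 < norm x" by auto
  obtain n where n: "dist (q n) p < \<bar>p \<bullet> x\<bar> / norm x" using assms(2) ne x by (metis divide_pos_pos zero_less_abs_iff)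
  have "\<bar>p \<bullet> x\<bar> = \<bar>(p - q n) \<bullet> x\<bar>" using assms(1) by (simp add: inner_diff_left)
  also have "\<dots> \<le> norm (p - q n) * norm x" by (rule Cauchy_Schwarz_ineq2)
  also have "\<dots> < \<bar>p \<bullet> x\<bar>" using n x by (simp add: dist_norm norm_minus_commute field_simps)
  finally show False by simp
qed

text \<open>
  A weighted sum of a dense sequence of positive diffuse vectors charges every one of them.
\<close>

lemma diffuse_weak_unit:
  assumes sep: "separable_space (euclidean :: 'h::abstract_L2_space topology)"
  shows "\<exists>e :: 'h. 0 \<le> e \<and> e \<in> diffuse \<and> (\<forall>f\<in>diffuse. 0 \<le> f \<longrightarrow> e \<bullet> f = 0 \<longrightarrow> f = 0)"
proof -
  let ?S = "{f \<in> diffuse. 0 \<le> (f :: 'h)}"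
  have "0 \<in> ?S" by (auto simp: diffuse_def)
  then obtain x where x: "range x \<subseteq> ?S" "\<And>h \<epsilon>. h \<in> ?S \<Longrightarrow> 0 < \<epsilon> \<Longrightarrow> \<exists>n :: nat. dist (x n) h < \<epsilon>"
    using dense_sequence_in_subset[OF sep, of ?S] by blast
  have x0: "0 \<le> x n" and xd: "x n \<in> diffuse" for n using x(1) by auto
  \<comment> \<open>the weights make the series converge absolutely\<close>
  define c where "c n = (1/2) ^ n / (1 + norm (x n))" for n
  have c: "0 < c n" for n unfolding c_def by (intro divide_pos_pos) (auto simp: add_pos_nonneg)
  have bound: "norm (c n *\<^sub>R x n) \<le> (1/2) ^ n" for n
  proof -
    have "(1/2 :: real) ^ n * (norm (x n) / (1 + norm (x n))) \<le> (1/2) ^ n * 1"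
      by (intro mult_left_mono) (auto simp: divide_le_eq_1 add_pos_nonneg)
    then show ?thesis using c[of n] by (simp add: c_def)
  qed
  have "summable (\<lambda>n. c n *\<^sub>R x n)"
  proof (rule summable_comparison_test')
    show "summable (\<lambda>n. (1/2 :: real) ^ n)" by (rule summable_geometric) simp
    show "norm (c n *\<^sub>R x n) \<le> (1/2) ^ n" if "0 \<le> n" for n by (rule bound)
  qed
  then obtain e where e: "(\<lambda>n. c n *\<^sub>R x n) sums e" by (auto simp: summable_def)
  have inner_sums: "(\<lambda>n. c n * (x n \<bullet> f)) sums (e \<bullet> f)" for f
    using bounded_linear.sums[OF bounded_linear_inner_left e, of f] by simp
  have "0 \<le> e"
  proof (rule LIMSEQ_lower_bound)
    show "(\<lambda>n. \<Sum>k<n. c k *\<^sub>R x k) \<longlonglongrightarrow> e" using e by (simp add: sums_def)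
    show "0 \<le> (\<Sum>k<n. c k *\<^sub>R x k)" for n
      using c x0 by (intro sum_nonneg scaleR_nonneg_nonneg) (auto intro: less_imp_le)
  qed
  moreover have "e \<in> diffuse"
    unfolding diffuse_def
  proof (intro CollectI ballI)
    fix a :: 'h assume a: "a \<in> atoms"
    then have "x n \<bullet> a = 0" for n using xd by (auto simp: diffuse_def inner_commute)
    then have "(\<lambda>n. 0) sums (e \<bullet> a)" using inner_sums[of a] by simp
    then show "a \<bullet> e = 0" using sums_unique2[OF sums_zero] by (metis inner_commute)
  qed
  moreover have "f = 0" if f: "f \<in> diffuse" "0 \<le> f" "e \<bullet> f = 0" for f
  proof -
    have nn: "0 \<le> c n * (x n \<bullet> f)" for n using c[of n] inner_nonneg[OF x0 f(2)] by simp
    have "x n \<bullet> f = 0" for n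
    proof -
      have "c n * (x n \<bullet> f) = 0"
        using suminf_eq_zero_iff[OF sums_summable[OF inner_sums[of f]] nn] sums_unique[OF inner_sums[of f]] f(3)
        by simp
      then show ?thesis using c[of n] by simp
    qed
    moreover have "\<exists>n. dist (x n) f < \<epsilon>" if "0 < \<epsilon>" for \<epsilon>
      using x(2)[OF _ that] f by simp
    ultimately have "f \<bullet> f = 0" by (rule inner_eq_0_of_dense)
    then show ?thesis by simp
  qed
  ultimately show ?thesis by blast
qed

text \<open>
  The components of a weak unit separate points: if \<open>p\<close> is the part of \<open>e\<close> in the band of the positive
  part \<open>m\<close> of \<open>x\<close>, then \<open>0 = p \<bullet> x = p \<bullet> m = e \<bullet> m\<close>, so \<open>m = 0\<close>. This replaces the
  approximation of individual vectors by simple functions.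
\<close>

lemma atoms_and_lattice_components_total:
  fixes e x :: "'h::abstract_L2_space"
  assumes e: "0 \<le> e" "\<And>f. f \<in> diffuse \<Longrightarrow> 0 \<le> f \<Longrightarrow> e \<bullet> f = 0 \<Longrightarrow> f = 0"
    and x: "x \<in> diffuse" "\<And>p. p \<in> lattice_components e \<Longrightarrow> p \<bullet> x = 0"
  shows "x = 0"
proof -
  have pos: "m = 0"
    if mn: "0 \<le> m" "0 \<le> n" "m - n \<in> diffuse" "m \<bullet> n = 0" "\<And>p. p \<in> lattice_components e \<Longrightarrow> p \<bullet> (m - n) = 0"
    for m n
  proof -
    obtain p where p: "p \<in> lattice_components e" "(e - p) \<bullet> m = 0"
        "\<And>g. 0 \<le> g \<Longrightarrow> m \<bullet> g = 0 \<Longrightarrow> p \<bullet> g = 0"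
      using band_component[OF e(1) mn(1)] by blast
    \<comment> \<open>\<open>p\<close> lies in the band of \<open>m\<close> and sees only the positive part of \<open>m - n\<close>\<close>
    have "p \<bullet> n = 0" using p(3) mn by blast
    then have "e \<bullet> m = 0" using mn(5)[OF p(1)] p(2) by (simp add: inner_diff_left inner_diff_right)
    then show ?thesis using e(2) diffuse_jordan[OF mn(3,1,2,4)] mn(1) by blast
  qed
  obtain m n where mn: "0 \<le> m" "0 \<le> n" "x = m - n" "m \<bullet> n = 0" by (rule jordan_decomposition)
  have "m = 0" using pos[of m n] mn x by simp
  moreover have "n - m \<in> diffuse" using x(1) mn(3) by (auto simp: diffuse_def inner_diff_right)
  then have "n = 0" using pos[of n m] mn x(2) by (simp add: inner_commute inner_diff_right)
  ultimately show ?thesis using mn(3) by simp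
qed

section \<open>Soft thresholding\<close>

text \<open>
  Soft thresholding moves \<open>t\<close> by \<open>\<tau>\<close> towards \<open>0\<close> and stops there, provided that \<open>0 \<le> \<tau>\<close>.
\<close>

definition soft :: "real \<Rightarrow> real \<Rightarrow> real"
  where "soft t \<tau> = max (t - \<tau>) 0 + min (t + \<tau>) 0"

lemma soft_lipschitz:
  assumes "0 \<le> \<tau>" "0 \<le> \<tau>'"
  shows "\<bar>soft t \<tau> - soft t' \<tau>'\<bar> \<le> \<bar>t - t'\<bar> + \<bar>\<tau> - \<tau>'\<bar>"
  using assms unfolding soft_def by linarith

lemma soft_near: "0 \<le> \<tau> \<Longrightarrow> \<bar>soft t \<tau> - t\<bar> \<le> \<tau>"
  unfolding soft_def max_def min_def by auto

lemma soft_nonneg: "0 \<le> t \<Longrightarrow> 0 \<le> \<tau> \<Longrightarrow> 0 \<le> soft t \<tau>"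
  unfolding soft_def by auto

lemma soft_eq_0: "\<bar>t\<bar> \<le> \<tau> \<Longrightarrow> soft t \<tau> = 0"
  unfolding soft_def by auto

text \<open>
  Orthogonal projection onto the span of \<open>U\<close> followed by soft thresholding of the coefficients. The
  threshold is proportional to the norm of \<open>h\<close> because the errors it has to absorb are.
\<close>

definition shrink :: "'a::real_inner set \<Rightarrow> real \<Rightarrow> 'a \<Rightarrow> 'a"
  where "shrink U \<delta> h = (\<Sum>u\<in>U. (soft (u \<bullet> h) (\<delta> * norm h) / (u \<bullet> u)) *\<^sub>R u)"

lemma norm_coefficients:
  fixes U :: "'a::real_inner set"
  assumes "finite U" "pairwise orthogonal U"
  shows "(norm (\<Sum>u\<in>U. (c u / (u \<bullet> u)) *\<^sub>R u))\<^sup>2 = (\<Sum>u\<in>U. (c u)\<^sup>2 / (u \<bullet> u))"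
  unfolding norm_sum_orthogonal[OF assms]
  by (intro sum.cong) (auto simp: power2_eq_square)

text \<open>
  Each coefficient varies by at most \<open>\<bar>u \<bullet> (h - k)\<bar> + \<delta> * \<parallel>h - k\<parallel>\<close>. The first terms are square
  summable by Bessel and the second ones by the bound on \<open>\<delta>\<close>, each with sum at most
  \<open>\<parallel>h - k\<parallel>\<^sup>2\<close>; the constant \<open>2\<close> comes from \<open>(a + b)\<^sup>2 \<le> 2 * a\<^sup>2 + 2 * b\<^sup>2\<close>.
\<close>

lemma shrink_lipschitz:
  fixes U :: "'a::real_inner set"
  assumes U: "finite U" "pairwise orthogonal U"
    and \<delta>: "0 \<le> \<delta>" "\<delta>\<^sup>2 * (\<Sum>u\<in>U. 1 / (u \<bullet> u)) \<le> 1"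
  shows "2-lipschitz_on UNIV (shrink U \<delta>)"
proof (rule lipschitz_onI)
  fix h k :: 'a
  let ?s = "\<lambda>h u. soft (u \<bullet> h) (\<delta> * norm h)"
  have "shrink U \<delta> h - shrink U \<delta> k = (\<Sum>u\<in>U. ((?s h u - ?s k u) / (u \<bullet> u)) *\<^sub>R u)"
    unfolding shrink_def sum_subtractf[symmetric]
    by (intro sum.cong) (auto simp: scaleR_diff_left diff_divide_distrib)
  then have "(norm (shrink U \<delta> h - shrink U \<delta> k))\<^sup>2 = (\<Sum>u\<in>U. (?s h u - ?s k u)\<^sup>2 / (u \<bullet> u))"
    using norm_coefficients[OF U] by simp
  also have "\<dots> \<le> (\<Sum>u\<in>U. 2 * ((u \<bullet> (h - k))\<^sup>2 / (u \<bullet> u)) + 2 * (\<delta> * norm (h - k))\<^sup>2 * (1 / (u \<bullet> u)))"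
  proof (rule sum_mono)
    fix u
    have "\<bar>?s h u - ?s k u\<bar> \<le> \<bar>u \<bullet> h - u \<bullet> k\<bar> + \<bar>\<delta> * norm h - \<delta> * norm k\<bar>"
      by (rule soft_lipschitz) (use \<delta> in auto)
    also have "\<bar>\<delta> * norm h - \<delta> * norm k\<bar> = \<delta> * \<bar>norm h - norm k\<bar>"
      using \<delta>(1) by (simp add: abs_mult flip: right_diff_distrib)
    also have "\<dots> \<le> \<delta> * norm (h - k)"
      using \<delta>(1) norm_triangle_ineq3 by (rule mult_left_mono[rotated])
    finally have "\<bar>?s h u - ?s k u\<bar> \<le> \<bar>u \<bullet> (h - k)\<bar> + \<delta> * norm (h - k)"
      by (simp add: inner_diff_right)
    then have "(?s h u - ?s k u)\<^sup>2 \<le> (\<bar>u \<bullet> (h - k)\<bar> + \<delta> * norm (h - k))\<^sup>2"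
      by (rule abs_le_square_iff[THEN iffD1, OF order_trans]) simp
    also have "\<dots> \<le> 2 * (u \<bullet> (h - k))\<^sup>2 + 2 * (\<delta> * norm (h - k))\<^sup>2"
      using sum_squares_bound[of "\<bar>u \<bullet> (h - k)\<bar>" "\<delta> * norm (h - k)"] by (simp add: power2_sum)
    finally show "(?s h u - ?s k u)\<^sup>2 / (u \<bullet> u)
        \<le> 2 * ((u \<bullet> (h - k))\<^sup>2 / (u \<bullet> u)) + 2 * (\<delta> * norm (h - k))\<^sup>2 * (1 / (u \<bullet> u))"
      using divide_right_mono[of _ _ "u \<bullet> u"] by (fastforce simp: add_divide_distrib)
  qed
  also have "\<dots> = 2 * (\<Sum>u\<in>U. (u \<bullet> (h - k))\<^sup>2 / (u \<bullet> u))
      + 2 * (norm (h - k))\<^sup>2 * (\<delta>\<^sup>2 * (\<Sum>u\<in>U. 1 / (u \<bullet> u)))"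
    by (simp add: sum.distrib sum_distrib_left power_mult_distrib mult_ac)
  also have "\<dots> \<le> 2 * (norm (h - k))\<^sup>2 + 2 * (norm (h - k))\<^sup>2 * 1"
    using bessel_inequality[OF U] \<delta>(2) by (intro add_mono mult_left_mono) auto
  also have "\<dots> = (2 * norm (h - k))\<^sup>2" by (simp add: power_mult_distrib)
  finally have "norm (shrink U \<delta> h - shrink U \<delta> k) \<le> 2 * norm (h - k)"
    by (rule power2_le_imp_le) simp
  then show "dist (shrink U \<delta> h) (shrink U \<delta> k) \<le> 2 * dist h k" by (simp add: dist_norm)
qed simp

lemma shrink_near_orth_proj:
  fixes U :: "'a::real_inner set"
  assumes U: "finite U" "pairwise orthogonal U" and \<delta>: "0 \<le> \<delta>"
  shows "(norm (shrink U \<delta> h - orth_proj U h))\<^sup>2 \<le> (norm h)\<^sup>2 * (\<delta>\<^sup>2 * (\<Sum>u\<in>U. 1 / (u \<bullet> u)))"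
proof -
  let ?s = "\<lambda>u. soft (u \<bullet> h) (\<delta> * norm h)"
  have "shrink U \<delta> h - orth_proj U h = (\<Sum>u\<in>U. ((?s u - u \<bullet> h) / (u \<bullet> u)) *\<^sub>R u)"
    unfolding shrink_def orth_proj_def sum_subtractf[symmetric]
    by (intro sum.cong) (auto simp: scaleR_diff_left diff_divide_distrib)
  then have "(norm (shrink U \<delta> h - orth_proj U h))\<^sup>2 = (\<Sum>u\<in>U. (?s u - u \<bullet> h)\<^sup>2 / (u \<bullet> u))"
    using norm_coefficients[OF U] by simp
  also have "\<dots> \<le> (\<Sum>u\<in>U. (\<delta> * norm h)\<^sup>2 / (u \<bullet> u))"
  proof (intro sum_mono divide_right_mono)
    fix u
    have "\<bar>?s u - u \<bullet> h\<bar> \<le> \<delta> * norm h" using soft_near \<delta> by simp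
    then show "(?s u - u \<bullet> h)\<^sup>2 \<le> (\<delta> * norm h)\<^sup>2"
      by (rule abs_le_square_iff[THEN iffD1, OF order_trans]) simp
  qed simp
  also have "\<dots> = (norm h)\<^sup>2 * (\<delta>\<^sup>2 * (\<Sum>u\<in>U. 1 / (u \<bullet> u)))"
    by (simp add: sum_distrib_left power_mult_distrib mult_ac)
  finally show ?thesis .
qed

lemma inner_shrink:
  fixes U :: "'a::real_inner set"
  assumes "finite U" "pairwise orthogonal U" "u \<in> U" "0 \<le> \<delta>" "u \<bullet> h = 0"
  shows "u \<bullet> shrink U \<delta> h = 0"
  using inner_sum_orthogonal[OF assms(1-3)] assms(4,5) soft_eq_0[of 0 "\<delta> * norm h"]
  unfolding shrink_def by simp

lemma shrink_nonneg:
  fixes U :: "'h::abstract_L2_space set"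
  assumes "\<And>u. u \<in> U \<Longrightarrow> 0 \<le> u" "\<And>u. u \<in> U \<Longrightarrow> 0 \<le> u \<bullet> h" "0 \<le> \<delta>"
  shows "0 \<le> shrink U \<delta> h"
  unfolding shrink_def using assms
  by (intro sum_nonneg scaleR_nonneg_nonneg divide_nonneg_nonneg soft_nonneg) auto

section \<open>Perturbing a partition to gain independence\<close>

text \<open>
  A vector of the span of \<open>V\<close> is constant on each cell \<open>x\<close>, that is, it has the same density on the two
  pieces \<open>w x\<close> and \<open>x - w x\<close>. The functional \<open>z\<close> measures the difference of these two densities; it
  kills the span of \<open>V\<close> and detects the perturbation \<open>\<epsilon> *\<^sub>R w x\<close>.
\<close>

lemma perturbed_independent:
  fixes V P :: "'h::abstract_L2_space set" and w :: "'h \<Rightarrow> 'h"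
  assumes V: "finite V" "pairwise orthogonal V"
    and w: "\<And>x. x \<in> V \<Longrightarrow> w x \<in> lattice_components x \<and> w x \<noteq> 0 \<and> w x \<noteq> x"
    and P: "independent P" "P \<subseteq> span V" and \<epsilon>: "\<epsilon> \<noteq> 0"
  shows "independent (P \<union> (\<lambda>x. x + \<epsilon> *\<^sub>R w x) ` V)"
proof (rule independent_Un)
  show "finite ((\<lambda>x. x + \<epsilon> *\<^sub>R w x) ` V)" using V(1) by simp
  show "independent P" by (rule P(1))
  fix u assume "u \<in> (\<lambda>x. x + \<epsilon> *\<^sub>R w x) ` V"
  then obtain x where x: "x \<in> V" "u = x + \<epsilon> *\<^sub>R w x" by blast
  have wx: "0 \<le> w x" "w x \<le> x" "w x \<bullet> (x - w x) = 0" "w x \<noteq> 0" "x - w x \<noteq> 0"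
    using w[OF x(1)] by (auto simp: lattice_components_def)
  define z where "z = (1 / (w x \<bullet> w x)) *\<^sub>R w x - (1 / ((x - w x) \<bullet> (x - w x))) *\<^sub>R (x - w x)"
  have other: "y' \<bullet> z = 0" if y: "y \<in> V" "y \<noteq> x" "0 \<le> y'" "y' \<le> y" for y y'
  proof -
    have yx: "y \<bullet> x = 0" using V(2) y(1,2) x(1) by (auto simp: pairwise_def orthogonal_def)
    have "y' \<bullet> w x = 0" by (rule inner_eq_0_mono[OF yx]) (use y wx in auto)
    moreover have "y' \<bullet> (x - w x) = 0" by (rule inner_eq_0_mono[OF yx]) (use y wx in auto)
    ultimately show ?thesis unfolding z_def inner_diff_right[of y' "_ *\<^sub>R _"] by simp
  qed
  have wz: "w x \<bullet> z = 1"
    using wx(3,4) unfolding z_def inner_diff_right[of _ "_ *\<^sub>R _"] by simp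
  have "(x - w x) \<bullet> w x = 0" using wx(3) by (simp add: inner_commute)
  then have "(x - w x) \<bullet> z = -1"
    using wx(5) unfolding z_def inner_diff_right[of _ "_ *\<^sub>R _"] by simp
  then have xz: "x \<bullet> z = 0" using wz by (simp add: inner_diff_left)
  have w0: "0 \<le> w y" "w y \<le> y" "0 \<le> y" if "y \<in> V" for y
    using w[OF that] order_trans[of 0 "w y" y] by (auto simp: lattice_components_def)
  have Vz: "y \<bullet> z = 0" if "y \<in> V" for y
    using other[OF that _ w0(3)[OF that] order_refl] xz by blast
  have "s \<bullet> z = 0" if "s \<in> P" for s
    using inner_span_eq_0[OF Vz] P(2) that by blast
  moreover have "s \<bullet> z = 0" if s: "s \<in> (\<lambda>x. x + \<epsilon> *\<^sub>R w x) ` V - {u}" for s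
  proof -
    obtain y where y: "y \<in> V" "y \<noteq> x" "s = y + \<epsilon> *\<^sub>R w y" using s x by blast
    then show ?thesis using Vz[OF y(1)] other[OF y(1,2) w0(1,2)[OF y(1)]] by (simp add: inner_add_left)
  qed
  moreover have "u \<bullet> z \<noteq> 0" using xz wz \<epsilon> by (simp add: x(2) inner_add_left)
  ultimately show "\<exists>z. (\<forall>s\<in>P \<union> ((\<lambda>x. x + \<epsilon> *\<^sub>R w x) ` V - {u}). s \<bullet> z = 0) \<and> u \<bullet> z \<noteq> 0"
    by blast
qed

text \<open>
  This is what the thresholding is for. Write \<open>g = \<Sum>\<^sub>x c\<^sub>x x\<close> with \<open>c\<^sub>x \<ge> 0\<close> and
  \<open>u\<^sub>x = x + \<epsilon> w\<^sub>x\<close>. If \<open>g \<bullet> h = 0\<close>, the numbers \<open>c\<^sub>x (u\<^sub>x \<bullet> h)\<close> are nonnegative and their sum is of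
  order \<open>\<epsilon> * \<parallel>h\<parallel>\<close>. Thus \<open>u\<^sub>x \<bullet> h\<close> stays below the threshold wherever \<open>c\<^sub>x > 0\<close>, while \<open>u\<^sub>x\<close> is
  orthogonal to \<open>g\<close> wherever \<open>c\<^sub>x = 0\<close>.
\<close>

lemma shrink_vanishes:
  fixes V A :: "'h::abstract_L2_space set" and w :: "'h \<Rightarrow> 'h"
  assumes V: "finite V" "pairwise orthogonal V" and w: "\<And>x. x \<in> V \<Longrightarrow> 0 \<le> w x \<and> w x \<le> x"
    and U: "U = (\<lambda>x. x + \<epsilon> *\<^sub>R w x) ` V \<union> A" and pos: "0 \<le> \<epsilon>" "0 \<le> \<delta>"
    and g: "0 \<le> g" "g \<in> span V" "\<And>a. a \<in> A \<Longrightarrow> g \<bullet> a = 0"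
    and small: "\<And>x. x \<in> V \<Longrightarrow> 0 < g \<bullet> x \<Longrightarrow>
      \<epsilon> * (\<Sum>y\<in>V. ((g \<bullet> y) / (y \<bullet> y)) * norm (w y)) \<le> \<delta> * ((g \<bullet> x) / (x \<bullet> x))"
    and h: "\<And>u. u \<in> U \<Longrightarrow> 0 \<le> u \<bullet> h" "g \<bullet> h = 0"
  shows "g \<bullet> shrink U \<delta> h = 0"
proof -
  have V0: "0 \<le> x" if "x \<in> V" for x using w[OF that] order_trans[of 0 "w x" x] by blast
  define c where "c x = (g \<bullet> x) / (x \<bullet> x)" for x
  have c: "0 \<le> c x" if "x \<in> V" for x using inner_nonneg[OF g(1) V0[OF that]] by (simp add: c_def)
  have g_eq: "g = (\<Sum>x\<in>V. c x *\<^sub>R x)"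
    using orth_proj_fixes_span[OF V g(2)] by (simp add: orth_proj_def c_def inner_commute)
  have summand: "soft (u \<bullet> h) (\<delta> * norm h) * (g \<bullet> u) = 0" if "u \<in> U" for u
  proof (cases "u \<in> A")
    case True
    then show ?thesis using g(3) by simp
  next
    case False
    then obtain x where x: "x \<in> V" "u = x + \<epsilon> *\<^sub>R w x" using \<open>u \<in> U\<close> U by blast
    show ?thesis
    proof (cases "g \<bullet> x = 0")
      case True
      then have "g \<bullet> w x = 0" by (rule inner_eq_0_mono) (use w[OF x(1)] g(1) in auto)
      then show ?thesis using True by (simp add: x(2) inner_add_right)
    next
      case False
      then have gx: "0 < g \<bullet> x" using inner_nonneg[OF g(1) V0[OF x(1)]] by simp
      then have "x \<noteq> 0" by auto
      then have cx: "0 < c x" using gx by (simp add: c_def)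
      have "c x * (u \<bullet> h) \<le> (\<Sum>y\<in>V. c y * ((y + \<epsilon> *\<^sub>R w y) \<bullet> h))"
        unfolding x(2)
        by (rule member_le_sum[of x V "\<lambda>y. c y * ((y + \<epsilon> *\<^sub>R w y) \<bullet> h)"])
          (use x(1) V(1) c h(1) U in auto)
      also have "\<dots> = g \<bullet> h + (\<Sum>y\<in>V. \<epsilon> * (c y * (w y \<bullet> h)))"
        by (simp add: g_eq inner_sum_left inner_add_left sum.distrib algebra_simps)
      also have "\<dots> \<le> (\<Sum>y\<in>V. \<epsilon> * (c y * (norm (w y) * norm h)))"
        using h(2) pos c norm_cauchy_schwarz by (auto intro!: sum_mono mult_left_mono)
      also have "\<dots> = \<epsilon> * (\<Sum>y\<in>V. c y * norm (w y)) * norm h"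
        by (simp add: sum_distrib_left sum_distrib_right mult_ac)
      also have "\<dots> \<le> \<delta> * c x * norm h"
        using small[OF x(1) gx] by (intro mult_right_mono) (simp_all add: c_def)
      finally have "c x * (u \<bullet> h) \<le> c x * (\<delta> * norm h)" by (simp add: mult_ac)
      then have "u \<bullet> h \<le> \<delta> * norm h" using cx by simp
      then show ?thesis using soft_eq_0 h(1)[OF \<open>u \<in> U\<close>] by simp
    qed
  qed
  have "g \<bullet> shrink U \<delta> h = (\<Sum>u\<in>U. soft (u \<bullet> h) (\<delta> * norm h) * (g \<bullet> u) / (u \<bullet> u))"
    unfolding shrink_def inner_sum_right by simp
  also have "\<dots> = 0" using summand by (intro sum.neutral) simp
  finally show ?thesis .
qed

text \<open>
  Each constraint holds for all sufficiently small \<open>\<epsilon> > 0\<close>, and there are finitely many of them.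
\<close>

lemma small_perturbation_exists:
  fixes P V :: "'h::abstract_L2_space set" and c d :: "'h \<Rightarrow> 'h \<Rightarrow> real"
  assumes "finite P" "finite V" "0 < \<gamma>" "\<And>g x. g \<in> P \<Longrightarrow> x \<in> V \<Longrightarrow> Q g x \<Longrightarrow> 0 < d g x"
  shows "\<exists>\<epsilon>>0. \<epsilon> * b \<le> (\<gamma>::real) \<and> (\<forall>g\<in>P. \<forall>x\<in>V. Q g x \<longrightarrow> \<epsilon> * c g x \<le> d g x)"
proof -
  have ev: "\<forall>\<^sub>F \<epsilon> in at_right 0. \<epsilon> * b \<le> \<gamma>" if "0 < \<gamma>" for b \<gamma> :: real
  proof -
    have "((\<lambda>\<epsilon>. \<epsilon> * b) \<longlongrightarrow> 0 * b) (at_right 0)" by (intro tendsto_intros)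
    then have "\<forall>\<^sub>F \<epsilon> in at_right 0. \<epsilon> * b < \<gamma>" using that by (intro order_tendstoD(2)) auto
    then show ?thesis by (rule eventually_mono) simp
  qed
  have "\<forall>\<^sub>F \<epsilon> in at_right 0. \<forall>g\<in>P. \<forall>x\<in>V. Q g x \<longrightarrow> \<epsilon> * c g x \<le> d g x"
  proof (intro eventually_ball_finite assms(1,2) ballI)
    fix g x assume "g \<in> P" "x \<in> V"
    then show "\<forall>\<^sub>F \<epsilon> in at_right 0. Q g x \<longrightarrow> \<epsilon> * c g x \<le> d g x"
      using ev[OF assms(4)] by (cases "Q g x") auto
  qed
  then have "\<forall>\<^sub>F \<epsilon> in at_right (0::real). 0 < \<epsilon> \<and> \<epsilon> * b \<le> \<gamma>
      \<and> (\<forall>g\<in>P. \<forall>x\<in>V. Q g x \<longrightarrow> \<epsilon> * c g x \<le> d g x)"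
    using ev[OF assms(3)] eventually_at_right_less by (intro eventually_conj) auto
  then show ?thesis using eventually_happens' trivial_limit_at_right_real by blast
qed

section \<open>The approximating systems\<close>

text \<open>
  The threshold \<open>\<delta>\<close> of a stage has to make \<open>\<delta>\<^sup>2 * (\<Sum>u. 1 / (u \<bullet> u))\<close> small for the perturbed system. As
  the perturbation only increases norms, it can be computed from the unperturbed cells \<open>V\<close> and the
  atoms \<open>A\<close>, before \<open>\<epsilon>\<close> is chosen in terms of it.
\<close>

definition threshold :: "nat \<Rightarrow> 'a::real_inner set \<Rightarrow> 'a set \<Rightarrow> real"
  where "threshold n V A = 1 / (real (Suc n) * (1 + ((\<Sum>x\<in>V. 1 / (x \<bullet> x)) + (\<Sum>a\<in>A. 1 / (a \<bullet> a)))))"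

lemma threshold_pos: "0 < threshold n V A"
proof -
  have "0 \<le> (\<Sum>x\<in>X. 1 / (x \<bullet> x))" for X :: "'a set" by (rule sum_nonneg) simp
  then have "0 < 1 + ((\<Sum>x\<in>V. 1 / (x \<bullet> x)) + (\<Sum>a\<in>A. 1 / (a \<bullet> a)))"
    by (meson add_nonneg_nonneg add_pos_nonneg zero_less_one)
  then show ?thesis unfolding threshold_def by (simp del: of_nat_Suc)
qed

lemma threshold_bound:
  assumes "S \<le> (\<Sum>x\<in>V. 1 / (x \<bullet> x)) + (\<Sum>a\<in>A. 1 / (a \<bullet> a))"
  shows "(threshold n V A)\<^sup>2 * S \<le> 1 / real (Suc n)"
proof -
  define T where "T = (\<Sum>x\<in>V. 1 / (x \<bullet> x)) + (\<Sum>a\<in>A. 1 / (a \<bullet> a))"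
  have T: "0 \<le> T" unfolding T_def by (intro add_nonneg_nonneg sum_nonneg) auto
  let ?N = "real (Suc n)"
  have "(threshold n V A)\<^sup>2 * S \<le> (threshold n V A)\<^sup>2 * (1 + T)\<^sup>2"
  proof (rule mult_left_mono)
    have "S \<le> 1 + T" using assms by (simp add: T_def)
    also have "\<dots> \<le> (1 + T)\<^sup>2" using T by (intro self_le_power) auto
    finally show "S \<le> (1 + T)\<^sup>2" .
  qed simp
  also have "\<dots> = (threshold n V A * (1 + T))\<^sup>2" by (simp add: power_mult_distrib)
  also have "threshold n V A * (1 + T) = 1 / ?N"
    using T unfolding threshold_def T_def[symmetric] by (simp del: of_nat_Suc)
  also have "(1 / ?N)\<^sup>2 \<le> 1 / ?N"
    by (simp add: power2_eq_square divide_le_eq mult_le_cancel_left1 del: of_nat_Suc) 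
  finally show ?thesis .
qed

text \<open>
  The data of stage \<open>n\<close>: \<open>P\<close> holds the diffuse generators of all earlier stages, \<open>V\<close> is a partition fine
  enough to have \<open>P\<close> in its span, and \<open>\<epsilon>\<close> is the size of the perturbation of its cells, small compared
  with every nonzero coefficient of the elements of \<open>P\<close>.
\<close>

definition stage :: "'h::abstract_L2_space \<Rightarrow> ('h \<Rightarrow> 'h) \<Rightarrow> (nat \<Rightarrow> 'h set) \<Rightarrow> nat \<Rightarrow> 'h set \<times> 'h set \<times> real \<Rightarrow> bool"
  where "stage e w A n = (\<lambda>(P, V, \<epsilon>).
    finite P \<and> independent P \<and> P \<subseteq> span V \<and> (\<forall>g\<in>P. 0 \<le> g) \<and>
    finite V \<and> pairwise orthogonal V \<and> V \<subseteq> lattice_components e - {0} \<and>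
    0 < \<epsilon> \<and> \<epsilon> * real (card V) \<le> 1 / real (Suc n) \<and>
    (\<forall>g\<in>P. \<forall>x\<in>V. 0 < g \<bullet> x \<longrightarrow>
      \<epsilon> * (\<Sum>y\<in>V. ((g \<bullet> y) / (y \<bullet> y)) * norm (w y)) \<le> threshold n V (A n) * ((g \<bullet> x) / (x \<bullet> x))))"

text \<open>
  The perturbed cells of one stage join the generators, and the next partition refines the old cells,
  their chosen pieces \<open>w x\<close> and the next member of the dense sequence \<open>q\<close>.
\<close>

lemma stage_sequence:
  fixes e :: "'h::abstract_L2_space" and w :: "'h \<Rightarrow> 'h"
  assumes e: "0 \<le> e" and q: "\<And>n. q n \<in> lattice_components e"
    and w: "\<And>x. x \<in> lattice_components e \<Longrightarrow> x \<noteq> 0 \<Longrightarrow> w x \<in> lattice_components x \<and> w x \<noteq> 0 \<and> w x \<noteq> x"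
  obtains P V :: "nat \<Rightarrow> 'h set" and E :: "nat \<Rightarrow> real"
  where "\<And>n. stage e w A n (P n, V n, E n)"
    and "\<And>n. P (Suc n) = P n \<union> (\<lambda>x. x + E n *\<^sub>R w x) ` V n"
    and "\<And>n. V n \<subseteq> span (V (Suc n))"
    and "\<And>n. q n \<in> span (V (Suc n))"
proof -
  let ?next = "\<lambda>n (P, V, \<epsilon>) (P', V', \<epsilon>'). P' = P \<union> (\<lambda>x. x + (\<epsilon>::real) *\<^sub>R w x) ` V
      \<and> V \<subseteq> span V' \<and> q n \<in> span V'"
  have "\<exists>f :: nat \<Rightarrow> 'h set \<times> 'h set \<times> real. \<forall>n. stage e w A n (f n) \<and> ?next n (f n) (f (Suc n))"
  proof (rule dependent_nat_choice)
    show "\<exists>s. stage e w A 0 s"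
      \<comment> \<open>there are no earlier generators, so the empty partition will do\<close>
      by (rule exI[of _ "({}, {}, 1)"]) (simp add: stage_def independent_empty)
  next
    fix s :: "'h set \<times> 'h set \<times> real" and n :: nat
    assume s: "stage e w A n s"
    obtain P V \<epsilon> where s_eq: "s = (P, V, \<epsilon>)" by (cases s)
    have P: "finite P" "independent P" "P \<subseteq> span V" "\<And>g. g \<in> P \<Longrightarrow> 0 \<le> g"
      and V: "finite V" "pairwise orthogonal V" "V \<subseteq> lattice_components e - {0}" and \<epsilon>: "0 < \<epsilon>"
      using s by (auto simp: stage_def s_eq)
    have wV: "w x \<in> lattice_components x \<and> w x \<noteq> 0 \<and> w x \<noteq> x" if "x \<in> V" for x using w V(3) that by blast
    define P' where "P' = P \<union> (\<lambda>x. x + \<epsilon> *\<^sub>R w x) ` V"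
    have "V \<union> w ` V \<union> {q n} \<subseteq> lattice_components e"
      using V(3) q wV component_trans by blast
    then obtain V' where V': "finite V'" "V' \<subseteq> lattice_components e - {0}" "pairwise orthogonal V'"
        "V \<union> w ` V \<union> {q n} \<subseteq> span V'"
      using common_refinement[OF _ _ e, of "V \<union> w ` V \<union> {q n}"] V(1) by auto
    have "span V \<subseteq> span V'" using V'(4) by (intro span_minimal) auto
    moreover have "x + \<epsilon> *\<^sub>R w x \<in> span V'" if "x \<in> V" for x
      using V'(4) that by (intro span_add span_scale) auto
    ultimately have P'V': "P' \<subseteq> span V'" using P(3) by (auto simp: P'_def)
    have P'0: "0 \<le> g" if g: "g \<in> P'" for g
    proof (cases "g \<in> P")
      case False
      then obtain x where x: "x \<in> V" "g = x + \<epsilon> *\<^sub>R w x" using g by (auto simp: P'_def)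
      have "0 \<le> x" "0 \<le> w x" using V(3) wV x(1) by (auto simp: lattice_components_def)
      then show ?thesis using \<epsilon> by (simp add: x(2) scaleR_nonneg_nonneg)
    qed (use P(4) in auto)
    have ind: "independent P'"
      unfolding P'_def using perturbed_independent[OF V(1,2) wV P(2,3)] \<epsilon> by simp
    have finP': "finite P'" using P(1) V(1) by (simp add: P'_def)
    have "\<exists>\<epsilon>'>0. \<epsilon>' * real (card V') \<le> 1 / real (Suc (Suc n)) \<and> (\<forall>g\<in>P'. \<forall>x\<in>V'. 0 < g \<bullet> x \<longrightarrow>
      \<epsilon>' * (\<Sum>y\<in>V'. ((g \<bullet> y) / (y \<bullet> y)) * norm (w y))
        \<le> threshold (Suc n) V' (A (Suc n)) * ((g \<bullet> x) / (x \<bullet> x)))"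
    proof (rule small_perturbation_exists[OF finP' V'(1)])
      fix g x assume "x \<in> V'" "0 < g \<bullet> x"
      moreover from this V'(2) have "x \<noteq> 0" by auto
      ultimately show "0 < threshold (Suc n) V' (A (Suc n)) * ((g \<bullet> x) / (x \<bullet> x))"
        using threshold_pos by (intro mult_pos_pos divide_pos_pos) auto
    qed simp
    then obtain \<epsilon>' where "0 < \<epsilon>'" "\<epsilon>' * real (card V') \<le> 1 / real (Suc (Suc n))"
      "\<forall>g\<in>P'. \<forall>x\<in>V'. 0 < g \<bullet> x \<longrightarrow>
      \<epsilon>' * (\<Sum>y\<in>V'. ((g \<bullet> y) / (y \<bullet> y)) * norm (w y))
        \<le> threshold (Suc n) V' (A (Suc n)) * ((g \<bullet> x) / (x \<bullet> x))" by blast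
    then have "stage e w A (Suc n) (P', V', \<epsilon>')"
      unfolding stage_def using finP' ind P'V' P'0 V'(1-3) by simp
    moreover have "?next n s (P', V', \<epsilon>')" using V'(4) by (simp add: s_eq P'_def)
    ultimately show "\<exists>s'. stage e w A (Suc n) s' \<and> ?next n s s'" by blast
  qed
  then obtain f :: "nat \<Rightarrow> 'h set \<times> 'h set \<times> real"
    where f_all: "\<forall>n. stage e w A n (f n) \<and> ?next n (f n) (f (Suc n))" by (rule exE)
  have f: "stage e w A n (f n)" "?next n (f n) (f (Suc n))" for n
    using spec[OF f_all, of n] by (rule conjunct1, rule conjunct2)
  show ?thesis
  proof (rule that[of "\<lambda>n. fst (f n)" "\<lambda>n. fst (snd (f n))" "\<lambda>n. snd (snd (f n))"])
    fix n
    show "stage e w A n (fst (f n), fst (snd (f n)), snd (snd (f n)))" using f(1)[of n] by simp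
    show "fst (f (Suc n)) = fst (f n) \<union> (\<lambda>x. x + snd (snd (f n)) *\<^sub>R w x) ` fst (snd (f n))"
      and "fst (snd (f n)) \<subseteq> span (fst (snd (f (Suc n))))"
      and "q n \<in> span (fst (snd (f (Suc n))))"
      using f(2)[of n] by (simp_all only: case_prod_beta)
  qed
qed

text \<open>
  Replacing each cell \<open>x\<close> by \<open>x + \<epsilon> *\<^sub>R w x\<close> in the expansion of the projection of \<open>h\<close> costs at most
  \<open>\<epsilon> * \<parallel>h\<parallel>\<close> per cell, and the result is a competitor for the best approximation in the perturbed span.
\<close>

lemma perturbed_orth_proj_tendsto:
  fixes V A :: "nat \<Rightarrow> 'h::abstract_L2_space set" and E :: "nat \<Rightarrow> real"
  assumes V: "\<And>n. finite (V n)" "\<And>n. pairwise orthogonal (V n \<union> A n)" "\<And>n. V n \<inter> A n = {}"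
    and A: "\<And>n. finite (A n)"
    and w: "\<And>n x. x \<in> V n \<Longrightarrow> 0 \<le> w x \<and> w x \<le> x \<and> x \<noteq> 0"
    and U: "\<And>n. U n = (\<lambda>x. x + E n *\<^sub>R w x) ` V n \<union> A n" "\<And>n. pairwise orthogonal (U n)"
    and E: "\<And>n. 0 < E n" "\<And>n. E n * real (card (V n)) \<le> 1 / real (Suc n)"
    and conv: "(\<lambda>n. orth_proj (V n \<union> A n) h) \<longlonglongrightarrow> h"
  shows "(\<lambda>n. orth_proj (U n) h) \<longlonglongrightarrow> h"
proof -
  have bound: "norm (h - orth_proj (U n) h)
      \<le> norm (h - orth_proj (V n \<union> A n) h) + norm h * (1 / real (Suc n))" for n
  proof -
    define c where "c x = (x \<bullet> h) / (x \<bullet> x)" for x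
    define r where "r = (\<Sum>x\<in>V n. (c x * E n) *\<^sub>R w x)"
    have "orth_proj (V n \<union> A n) h = (\<Sum>x\<in>V n. c x *\<^sub>R x) + (\<Sum>a\<in>A n. c a *\<^sub>R a)"
      unfolding orth_proj_def c_def using V(1,3) A by (intro sum.union_disjoint) auto
    then have eq: "orth_proj (V n \<union> A n) h + r
        = (\<Sum>x\<in>V n. c x *\<^sub>R (x + E n *\<^sub>R w x)) + (\<Sum>a\<in>A n. c a *\<^sub>R a)"
      by (simp add: r_def scaleR_add_right sum.distrib)
    have "orth_proj (V n \<union> A n) h + r \<in> span (U n)"
      unfolding eq U(1) by (intro span_add span_sum span_scale span_base) auto
    then have "norm (h - orth_proj (U n) h) \<le> norm (h - (orth_proj (V n \<union> A n) h + r))"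
      using V(1) A U by (intro orth_proj_best) auto
    also have "\<dots> \<le> norm (h - orth_proj (V n \<union> A n) h) + norm r"
      using norm_triangle_ineq4[of "h - orth_proj (V n \<union> A n) h" r] by (simp add: algebra_simps)
    also have "norm r \<le> (\<Sum>x\<in>V n. norm ((c x * E n) *\<^sub>R w x))"
      unfolding r_def by (rule norm_sum)
    also have "\<dots> \<le> (\<Sum>x\<in>V n. E n * norm h)"
    proof (rule sum_mono)
      fix x assume x: "x \<in> V n"
      have nx: "0 < norm x" using w[OF x] by simp
      have "\<bar>c x\<bar> * norm (w x) \<le> \<bar>c x\<bar> * norm x"
        using w[OF x] norm_mono_nonneg[of "w x" x] by (intro mult_left_mono) auto
      also have "\<dots> = \<bar>x \<bullet> h\<bar> / norm x"
        using nx by (simp add: c_def dot_square_norm power2_eq_square)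
      also have "\<dots> \<le> norm h" using Cauchy_Schwarz_ineq2[of x h] nx by (simp add: divide_le_eq mult.commute)
      finally have "E n * (\<bar>c x\<bar> * norm (w x)) \<le> E n * norm h"
        using E(1)[of n] by (intro mult_left_mono) auto
      moreover have "norm ((c x * E n) *\<^sub>R w x) = E n * (\<bar>c x\<bar> * norm (w x))"
        using E(1)[of n] by (simp add: abs_mult mult_ac)
      ultimately show "norm ((c x * E n) *\<^sub>R w x) \<le> E n * norm h" by (simp only:)
    qed
    also have "\<dots> = norm h * (E n * real (card (V n)))" by simp
    also have "\<dots> \<le> norm h * (1 / real (Suc n))" using E(2) by (rule mult_left_mono) simp
    finally show ?thesis by simp
  qed
  have "(\<lambda>n. h - orth_proj (V n \<union> A n) h) \<longlonglongrightarrow> h - h"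
    by (intro tendsto_diff tendsto_const conv)
  then have "(\<lambda>n. norm (h - orth_proj (V n \<union> A n) h)) \<longlonglongrightarrow> 0"
    by (simp add: tendsto_norm_zero)
  from tendsto_add[OF this tendsto_mult_right_zero[OF LIMSEQ_Suc[OF lim_1_over_n], of "norm h"]]
  have lim: "(\<lambda>n. norm (h - orth_proj (V n \<union> A n) h) + norm h * (1 / real (Suc n))) \<longlonglongrightarrow> 0"
    by simp
  have "(\<lambda>n. h - orth_proj (U n) h) \<longlonglongrightarrow> 0"
    by (rule Lim_null_comparison[OF always_eventually lim]) (use bound in blast)
  then have "(\<lambda>n. h - (h - orth_proj (U n) h)) \<longlonglongrightarrow> h - 0" by (intro tendsto_intros)
  then show ?thesis by simp
qed

text \<open>
  \<open>U n\<close> is the orthogonal system onto which the \<open>n\<close>-th map projects: the perturbed cells of stage \<open>n\<close>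
  and the first atoms. \<open>G n\<close> collects these systems up to stage \<open>n\<close>. The atoms are not perturbed: an
  atom has no proper component, and it enters the generators only once.
\<close>

lemma approximating_systems:
  assumes sep: "separable_space (euclidean :: 'h::abstract_L2_space topology)"
  obtains G U :: "nat \<Rightarrow> 'h::abstract_L2_space set" and \<delta> :: "nat \<Rightarrow> real"
  where "\<And>n. finite (G n)" "\<And>n. independent (G n)" "\<And>n. G n \<subseteq> G (Suc n)"
    and "\<And>n g. g \<in> G n \<Longrightarrow> 0 \<le> g"
    and "\<And>n. U n \<subseteq> G n" "\<And>n. pairwise orthogonal (U n)" "\<And>n. 0 \<le> \<delta> n"
    and "\<And>n. (\<delta> n)\<^sup>2 * (\<Sum>u\<in>U n. 1 / (u \<bullet> u)) \<le> 1 / real (Suc n)"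
    and "\<And>h. (\<lambda>n. orth_proj (U n) h) \<longlonglongrightarrow> h"
    and "\<And>n g h. g \<in> G n \<Longrightarrow> h \<in> dual_cone (G n) \<Longrightarrow> g \<bullet> h = 0 \<Longrightarrow> g \<bullet> shrink (U n) (\<delta> n) h = 0"
proof -
  obtain e :: 'h where e: "0 \<le> e" "e \<in> diffuse"
      "\<And>f. f \<in> diffuse \<Longrightarrow> 0 \<le> f \<Longrightarrow> e \<bullet> f = 0 \<Longrightarrow> f = 0"
    using diffuse_weak_unit[OF sep] by blast
  have comp_diffuse: "x \<in> diffuse" if "x \<in> lattice_components e" for x
    using diffuse_below[OF e(2)] that by (auto simp: lattice_components_def)
  define w where "w x = (SOME y. y \<in> lattice_components x \<and> y \<noteq> 0 \<and> y \<noteq> x)" for x :: 'h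
  have w: "w x \<in> lattice_components x \<and> w x \<noteq> 0 \<and> w x \<noteq> x" if x: "x \<in> lattice_components e" "x \<noteq> 0" for x
  proof -
    have "0 \<le> x" using x(1) by (simp add: lattice_components_def)
    then have "\<exists>y. y \<in> lattice_components x \<and> y \<noteq> 0 \<and> y \<noteq> x"
      using diffuse_split[OF comp_diffuse[OF x(1)] _ x(2)] by blast
    then show ?thesis unfolding w_def by (rule someI_ex)
  qed
  have "e \<in> lattice_components e" using e(1) by (simp add: lattice_components_def)
  then obtain q :: "nat \<Rightarrow> 'h" where q_range: "range q \<subseteq> lattice_components e"
    and q_dense: "\<And>p \<epsilon>. p \<in> lattice_components e \<Longrightarrow> 0 < \<epsilon> \<Longrightarrow> \<exists>n. dist (q n) p < \<epsilon>"
    using dense_sequence_in_subset[OF sep, of "lattice_components e"] by blast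
  have q: "q n \<in> lattice_components e" for n using q_range by blast
  define A :: "nat \<Rightarrow> 'h set" where "A n = {a \<in> atoms. to_nat_on atoms a < n}" for n
  have A_fin: "finite (A n)" for n
  proof (rule finite_imageD)
    show "finite (to_nat_on atoms ` A n)" by (rule finite_subset[of _ "{..<n}"]) (auto simp: A_def)
    show "inj_on (to_nat_on atoms) (A n)"
      by (rule inj_on_subset[OF inj_on_to_nat_on[OF countable_atoms[OF sep]]]) (auto simp: A_def)
  qed
  have A_atoms: "A n \<subseteq> atoms" for n by (auto simp: A_def)
  obtain P V :: "nat \<Rightarrow> 'h set" and E :: "nat \<Rightarrow> real"
    where st: "\<And>n. stage e w A n (P n, V n, E n)"
    and PSuc: "\<And>n. P (Suc n) = P n \<union> (\<lambda>x. x + E n *\<^sub>R w x) ` V n"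
    and VSuc: "\<And>n. V n \<subseteq> span (V (Suc n))" and qV: "\<And>n. q n \<in> span (V (Suc n))"
    by (rule stage_sequence[where e = e and q = q and A = A and w = w], rule e(1), rule q, erule (1) w, rule that)
  have P: "finite (P n)" "independent (P n)" "P n \<subseteq> span (V n)" "\<And>g. g \<in> P n \<Longrightarrow> 0 \<le> g"
    and V: "finite (V n)" "pairwise orthogonal (V n)" "V n \<subseteq> lattice_components e - {0}"
    and E: "0 < E n" "E n * real (card (V n)) \<le> 1 / real (Suc n)"
    and small: "\<And>g x. g \<in> P n \<Longrightarrow> x \<in> V n \<Longrightarrow> 0 < g \<bullet> x \<Longrightarrow>
      E n * (\<Sum>y\<in>V n. ((g \<bullet> y) / (y \<bullet> y)) * norm (w y)) \<le> threshold n (V n) (A n) * ((g \<bullet> x) / (x \<bullet> x))"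
    for n using st[of n] by (auto simp: stage_def)
  have wV: "0 \<le> w x" "w x \<le> x" "x \<noteq> 0" "0 \<le> x" if "x \<in> V n" for x n
  proof -
    have x: "x \<in> lattice_components e" "x \<noteq> 0" using V(3) that by blast+
    then show "0 \<le> w x" "w x \<le> x" "x \<noteq> 0" "0 \<le> x"
      using w[OF x] by (simp_all add: lattice_components_def)
  qed
  have V_diffuse: "x \<in> diffuse" if "x \<in> V n" for x n using V(3) that comp_diffuse by blast
  have AV: "a \<bullet> x = 0" if "a \<in> atoms" "x \<in> span (V n)" for a x n
  proof -
    have "x \<bullet> a = 0"
      by (rule inner_span_eq_0[OF _ that(2)]) (use V_diffuse that(1) in \<open>auto simp: diffuse_def inner_commute\<close>)
    then show ?thesis by (simp add: inner_commute)
  qed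
  have PV: "P (Suc n) \<subseteq> span (V (Suc n))" for n by (rule P(3))
  define N where "N n = (\<lambda>x. x + E n *\<^sub>R w x) ` V n" for n
  define U where "U n = N n \<union> A n" for n
  define G where "G n = P (Suc n) \<union> A n" for n
  define \<delta> where "\<delta> n = threshold n (V n) (A n)" for n
  have \<delta>_nonneg: "0 \<le> \<delta> n" for n
    unfolding \<delta>_def by (rule less_imp_le[OF threshold_pos])
  have N_sub: "N n \<subseteq> span (V (Suc n))" for n using PV[of n] PSuc[of n] by (auto simp: N_def)
  have AA: "pairwise orthogonal (A n)" for n
    by (rule pairwise_subset[OF atoms_orthogonal A_atoms])
  have orthogonal_Un: "pairwise orthogonal (X \<union> A n)"
    if "pairwise orthogonal X" "X \<subseteq> span (V m)" for X n m
  proof -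
    have "x \<bullet> a = 0 \<and> a \<bullet> x = 0" if "x \<in> X" "a \<in> A n" for x a
      using AV[of a x m] A_atoms \<open>X \<subseteq> span (V m)\<close> that by (auto simp: inner_commute)
    then show ?thesis using that(1) AA[of n] unfolding pairwise_def orthogonal_def by blast
  qed
  have N_orth: "pairwise orthogonal (N n)" for n
    unfolding pairwise_def orthogonal_def
  proof (intro ballI impI)
    fix u v assume "u \<in> N n" "v \<in> N n" "u \<noteq> v"
    then obtain x y where xy: "x \<in> V n" "y \<in> V n" "x \<noteq> y" "u = x + E n *\<^sub>R w x" "v = y + E n *\<^sub>R w y"
      by (auto simp: N_def)
    have "x \<bullet> y = 0" using V(2) xy by (auto simp: pairwise_def orthogonal_def)
    then have "x' \<bullet> y' = 0" if "0 \<le> x'" "x' \<le> x" "0 \<le> y'" "y' \<le> y" for x' y'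
      using inner_eq_0_mono that by blast
    then show "u \<bullet> v = 0" using wV[OF xy(1)] wV[OF xy(2)]
      by (simp add: xy(4,5) inner_add_left inner_add_right)
  qed
  have U_orth: "pairwise orthogonal (U n)" for n
    unfolding U_def using orthogonal_Un[OF N_orth N_sub] .
  have VA_orth: "pairwise orthogonal (V n \<union> A n)" for n
    using orthogonal_Un[OF V(2), of n n n] by (auto intro: span_base)
  have U_fin: "finite (U n)" for n using V(1) A_fin by (simp add: U_def N_def)
  have VA_disj: "V n \<inter> A n = {}" for n
  proof (rule ccontr)
    assume "V n \<inter> A n \<noteq> {}"
    then obtain a where a: "a \<in> V n" "a \<in> A n" by blast
    then have "a \<bullet> a = 0" using AV[of a a n] A_atoms by (auto intro: span_base)
    then show False using wV(3)[OF a(1)] by simp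
  qed
  have U_G: "U n \<subseteq> G n" for n by (auto simp: U_def G_def PSuc N_def)
  have G_pos: "0 \<le> g" if "g \<in> G n" for g n
    using that P(4)[of g "Suc n"] A_atoms[of n] by (auto simp: G_def atoms_def)
  have proj: "(\<lambda>n. orth_proj (V n \<union> A n) h) \<longlonglongrightarrow> h" for h
  proof (rule orth_proj_tendsto[OF _ VA_orth])
    show "finite (V n \<union> A n)" for n using V(1) A_fin by simp
    show "V n \<union> A n \<subseteq> span (V (Suc n) \<union> A (Suc n))" for n
    proof -
      have "A n \<subseteq> A (Suc n)" by (auto simp: A_def)
      then show ?thesis
        using VSuc[of n] span_mono[of "V (Suc n)" "V (Suc n) \<union> A (Suc n)"] by (auto intro: span_base)
    qed
    fix x assume x: "\<And>n s. s \<in> V n \<union> A n \<Longrightarrow> s \<bullet> x = 0"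
    have "x \<in> diffuse"
      unfolding diffuse_def
    proof (intro CollectI ballI)
      fix a :: 'h assume "a \<in> atoms"
      then have "a \<in> A (Suc (to_nat_on atoms a))" by (simp add: A_def)
      then show "a \<bullet> x = 0" using x by blast
    qed
    moreover have "p \<bullet> x = 0" if "p \<in> lattice_components e" for p
    proof (rule inner_eq_0_of_dense)
      show "q n \<bullet> x = 0" for n by (rule inner_span_eq_0[OF _ qV]) (use x in blast)
    qed (rule q_dense[OF that])
    ultimately show "x = 0" using atoms_and_lattice_components_total[OF e(1,3)] by blast
  qed
  show ?thesis
  proof (rule that[of G U \<delta>])
    fix n
    show "finite (G n)" using P(1) A_fin by (simp add: G_def)
    show "independent (G n)"
      unfolding G_def
    proof (rule independent_Un[OF A_fin P(2)])
      fix a assume a: "a \<in> A n"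
      then have "a \<bullet> a = 1" by (simp add: A_def atoms_def norm_eq_1)
      moreover have "s \<bullet> a = 0" if "s \<in> P (Suc n)" for s
        using AV[of a s "Suc n"] A_atoms a PV that by (auto simp: inner_commute)
      moreover have "s \<bullet> a = 0" if "s \<in> A n - {a}" for s
        using AA a that by (auto simp: pairwise_def orthogonal_def)
      ultimately show "\<exists>z. (\<forall>s\<in>P (Suc n) \<union> (A n - {a}). s \<bullet> z = 0) \<and> a \<bullet> z \<noteq> 0"
        by (intro exI[of _ a]) auto
    qed
    show "G n \<subseteq> G (Suc n)" by (auto simp: G_def PSuc[of "Suc n"] A_def)
    show "U n \<subseteq> G n" by (rule U_G)
    show "pairwise orthogonal (U n)" by (rule U_orth)
    show "0 \<le> \<delta> n" by (rule \<delta>_nonneg)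
    show "(\<delta> n)\<^sup>2 * (\<Sum>u\<in>U n. 1 / (u \<bullet> u)) \<le> 1 / real (Suc n)"
      unfolding \<delta>_def
    proof (rule threshold_bound)
      have nonneg: "0 \<le> sum (\<lambda>u :: 'h. 1 / (u \<bullet> u)) X" for X by (intro sum_nonneg) auto
      have "(\<Sum>u\<in>U n. 1 / (u \<bullet> u)) \<le> (\<Sum>u\<in>N n. 1 / (u \<bullet> u)) + (\<Sum>a\<in>A n. 1 / (a \<bullet> a))"
        using sum.union_inter[of "N n" "A n" "\<lambda>u. 1 / (u \<bullet> u)"] V(1) A_fin nonneg[of "N n \<inter> A n"]
        unfolding U_def N_def by simp
      also have "(\<Sum>u\<in>N n. 1 / (u \<bullet> u)) \<le> (\<Sum>x\<in>V n. 1 / ((x + E n *\<^sub>R w x) \<bullet> (x + E n *\<^sub>R w x)))"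
        unfolding N_def using sum_image_le[OF V(1)[of n], of "\<lambda>u. 1 / (u \<bullet> u)" "\<lambda>x. x + E n *\<^sub>R w x"]
        by (simp add: o_def)
      also have "\<dots> \<le> (\<Sum>x\<in>V n. 1 / (x \<bullet> x))"
      proof (rule sum_mono)
        fix x assume x: "x \<in> V n"
        have "x \<le> x + E n *\<^sub>R w x" using wV[OF x] E(1)[of n] by (simp add: scaleR_nonneg_nonneg)
        then have "norm x \<le> norm (x + E n *\<^sub>R w x)" using wV(4)[OF x] by (rule norm_mono_nonneg[rotated])
        then have "x \<bullet> x \<le> (x + E n *\<^sub>R w x) \<bullet> (x + E n *\<^sub>R w x)" by (simp add: norm_le)
        then show "1 / ((x + E n *\<^sub>R w x) \<bullet> (x + E n *\<^sub>R w x)) \<le> 1 / (x \<bullet> x)"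
          using wV(3)[OF x] by (intro frac_le) auto
      qed
      finally show "(\<Sum>u\<in>U n. 1 / (u \<bullet> u)) \<le> (\<Sum>x\<in>V n. 1 / (x \<bullet> x)) + (\<Sum>a\<in>A n. 1 / (a \<bullet> a))"
        by simp
    qed
  next
    fix h
    show "(\<lambda>n. orth_proj (U n) h) \<longlonglongrightarrow> h"
      by (rule perturbed_orth_proj_tendsto[OF V(1) VA_orth VA_disj A_fin _ _ U_orth E proj])
        (use wV in \<open>auto simp: U_def N_def\<close>)
  next
    fix n g h assume gh: "g \<in> G n" "h \<in> dual_cone (G n)" "g \<bullet> h = 0"
    show "g \<bullet> shrink (U n) (\<delta> n) h = 0"
    proof (cases "g \<in> U n")
      case True
      show ?thesis
        by (rule inner_shrink[OF U_fin U_orth True \<delta>_nonneg gh(3)])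
    next
      case False
      then have g: "g \<in> P n" using gh(1) by (auto simp: G_def U_def PSuc N_def)
      show ?thesis
      proof (rule shrink_vanishes[OF V(1,2) _ U_def[unfolded N_def]])
        show "0 \<le> w x \<and> w x \<le> x" if "x \<in> V n" for x using wV[OF that] by simp
        show "g \<in> span (V n)" using P(3) g by blast
        show "g \<bullet> a = 0" if "a \<in> A n" for a
          using AV[of a g n] A_atoms[of n] that P(3)[of n] g by (auto simp: inner_commute)
        show "E n * (\<Sum>y\<in>V n. ((g \<bullet> y) / (y \<bullet> y)) * norm (w y)) \<le> \<delta> n * ((g \<bullet> x) / (x \<bullet> x))"
          if "x \<in> V n" "0 < g \<bullet> x" for x unfolding \<delta>_def by (rule small[OF g that])
        show "0 \<le> u \<bullet> h" if "u \<in> U n" for u using gh(2) U_G[of n] that by (auto simp: dual_cone_def)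
      qed (use E(1)[of n] \<delta>_nonneg P(4)[OF g] gh(3) in auto)
    qed
  qed (use G_pos in auto)
qed

text \<open>
  The finite sets \<open>G n\<close> generate the approximating cones and thresholded projections serve as the maps
  \<open>\<pi>\<^sub>n\<close>. That the cones shrink to the positive cone comes for free: a vector \<open>h\<close> in all of them is the
  limit of the positive vectors \<open>\<pi>\<^sub>n h\<close>.
\<close>

theorem proposition10p5:
  assumes "separable_space (euclidean :: 'h::abstract_L2_space topology)"
  shows "approximately_generated_by_basis (positive_cone :: 'h set) positive_cone"
proof -
  obtain G U :: "nat \<Rightarrow> 'h set" and \<delta> :: "nat \<Rightarrow> real"
  where fin: "\<And>n. finite (G n)" and ind: "\<And>n. independent (G n)" and mono: "\<And>n. G n \<subseteq> G (Suc n)"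
    and pos: "\<And>n g. g \<in> G n \<Longrightarrow> 0 \<le> g"
    and UG: "\<And>n. U n \<subseteq> G n" and orth: "\<And>n. pairwise orthogonal (U n)" and \<delta>: "\<And>n. 0 \<le> \<delta> n"
    and small: "\<And>n. (\<delta> n)\<^sup>2 * (\<Sum>u\<in>U n. 1 / (u \<bullet> u)) \<le> 1 / real (Suc n)"
    and proj: "\<And>h. (\<lambda>n. orth_proj (U n) h) \<longlonglongrightarrow> h"
    and face: "\<And>n g h. g \<in> G n \<Longrightarrow> h \<in> dual_cone (G n) \<Longrightarrow> g \<bullet> h = 0 \<Longrightarrow> g \<bullet> shrink (U n) (\<delta> n) h = 0"
    by (rule approximating_systems[OF assms]) (rule that)
  have Ufin: "finite (U n)" for n using fin UG finite_subset by blast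
  define K where "K n = dual_cone (G n)" for n
  define \<pi> where "\<pi> n = shrink (U n) (\<delta> n)" for n
  have lip: "2-lipschitz_on UNIV (\<pi> n)" for n
  proof -
    have "(\<delta> n)\<^sup>2 * (\<Sum>u\<in>U n. 1 / (u \<bullet> u)) \<le> 1"
      using small[of n] by (rule order_trans) simp
    then show ?thesis unfolding \<pi>_def by (rule shrink_lipschitz[OF Ufin orth \<delta>])
  qed
  have \<pi>_pos: "\<pi> n h \<in> positive_cone" if "h \<in> K n" for n h
  proof -
    have "0 \<le> shrink (U n) (\<delta> n) h"
    proof (rule shrink_nonneg)
      fix u assume "u \<in> U n"
      then have "u \<in> G n" using UG by blast
      then show "0 \<le> u" "0 \<le> u \<bullet> h" using pos that by (auto simp: K_def dual_cone_def)
    qed (rule \<delta>)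
    then show ?thesis by (simp add: \<pi>_def positive_cone_def)
  qed
  have \<pi>_conv: "(\<lambda>n. \<pi> n h) \<longlonglongrightarrow> h" for h
  proof -
    have "(\<lambda>n. \<pi> n h - orth_proj (U n) h) \<longlonglongrightarrow> 0"
    proof (rule tendsto_norm_zero_cancel)
      have "(norm (\<pi> n h - orth_proj (U n) h))\<^sup>2 \<le> (norm h)\<^sup>2 * (1 / real (Suc n))" for n
        unfolding \<pi>_def by (rule order_trans[OF shrink_near_orth_proj[OF Ufin orth \<delta>]])
          (rule mult_left_mono[OF small], simp)
      then have "norm ((norm (\<pi> n h - orth_proj (U n) h))\<^sup>2) \<le> (norm h)\<^sup>2 * (1 / real (Suc n))" for n
        by (simp del: of_nat_Suc)
      moreover have "(\<lambda>n. (norm h)\<^sup>2 * (1 / real (Suc n))) \<longlonglongrightarrow> 0"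
        by (rule tendsto_mult_right_zero[OF LIMSEQ_Suc[OF lim_1_over_n]])
      ultimately have "(\<lambda>n. (norm (\<pi> n h - orth_proj (U n) h))\<^sup>2) \<longlonglongrightarrow> 0"
        by (rule Lim_null_comparison[OF always_eventually[OF allI]])
      then show "(\<lambda>n. norm (\<pi> n h - orth_proj (U n) h)) \<longlonglongrightarrow> 0" by simp
    qed
    from tendsto_add[OF this proj[of h]] show ?thesis by simp
  qed
  have sub: "positive_cone \<subseteq> K n" for n
    using pos inner_nonneg by (auto simp: K_def dual_cone_def positive_cone_def)
  have "positive_cone = (\<Inter>n. K n)"
  proof
    show "(\<Inter>n. K n) \<subseteq> positive_cone"
    proof
      fix h assume "h \<in> (\<Inter>n. K n)"
      then have "\<pi> n h \<in> positive_cone" for n using \<pi>_pos by blast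
      then show "h \<in> positive_cone"
        using closed_sequentially[OF closed_positive_cone _ \<pi>_conv] by blast
    qed
  qed (use sub in blast)
  moreover have "cone_with_generating_system (positive_cone :: 'h set) positive_cone"
    unfolding cone_with_generating_system_def
    using closed_positive_cone convex_cone_dual_cone[of "positive_cone :: 'h set"] by (simp add: dual_positive_cone)
  moreover have "generated_by_basis (K n) (G n)" for n
    unfolding K_def by (rule generated_by_basis_dual_cone[OF assms fin ind])
  moreover have "K (Suc n) \<subseteq> K n" for n
    using mono[of n] by (auto simp: K_def dual_cone_def)
  \<comment> \<open>the generators are positive vectors themselves, so a constant sequence suffices\<close>
  moreover have "\<exists>g :: nat \<Rightarrow> 'h. (\<forall>m. g m \<in> positive_cone) \<and> g \<longlonglongrightarrow> h' \<and> (\<forall>m. g m \<bullet> h = 0)"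
    if "h' \<in> (\<Union>n. G n)" "h' \<bullet> h = 0" for h' h
    using that pos by (intro exI[of _ "\<lambda>_. h'"]) (auto simp: positive_cone_def)
  moreover have "h' \<bullet> \<pi> n h = 0" if "h' \<in> G n" "h \<in> K n" "h' \<bullet> h = 0" for n h' h
    using face that by (simp add: K_def \<pi>_def)
  ultimately show ?thesis
    unfolding approximately_generated_by_basis_def
    using sub mono lip \<pi>_pos \<pi>_conv
    by (intro conjI exI[of _ K] exI[of _ G] exI[of _ "2::real"] exI[of _ \<pi>]) (auto simp del: UN_iff)
qed

end
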